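(* Let $\mathbb{H}P^3$ be quaternionic projective $3$-space (of real dimension $12$). Let $A$, $B$, $C$ be three copies of the canonical quaternionic line bundle over $\mathbb{H}P^3$, regarded as a complex vector bundle of rank $2$, whose second Chern class is the generator $1 \in H^4(\mathbb{H}P^3;\mathbb{Z}) \cong \mathbb{Z}$, and let $P = A \otimes B \otimes C$. Then $P$ has no untwisted nowhere vanishing continuous section $\Gamma$ with $\Gamma(x) \in V_2'$ for all $x \in \mathbb{H}P^3$.
   Context: Let $A, B, C$ be rank-$2$ complex vector bundles (with unitary structure group) over a base $X$ and $P = A \otimes B \otimes C$. A nonzero vector of $A_x \otimes B_x \otimes C_x$ is of type $\overline{A-BC}$ if it has the form $|a\rangle \otimes |\phi_{BC}\rangle$ with $|a\rangle \in A_x$ and $|\phi_{BC}\rangle \in B_x \otimes C_x$ (where $\phi_{BC}$ is allowed to be simple or entangled). The types $\overline{B-CA}$ and $\overline{C-AB}$ are defined analogously by splitting off the $B$ factor or the $C$ factor. $V_2'$ denotes the set of nonzero vectors that are of at least one of these three types (vectors with at most bipartite entanglement). Let $\Gamma$ be a nowhere vanishing continuous section of $P$ with $\Gamma(x) \in V_2'$ for all $x \in X$. Put $X_{BC} = \{x : \Gamma(x) \text{ is of type } \overline{A-BC}\}$, and similarly $X_{CA}$ and $X_{AB}$ for the types $\overline{B-CA}$ and $\overline{C-AB}$; these are closed sets covering $X$. Over $X_{BC}$ we have $\Gamma = |a\rangle \otimes |\phi_{BC}\rangle$ with the factors unique up to reciprocal nonzero scalars, so $\Gamma$ determines projective sections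 $|\hat a\rangle$ of the projectivization $\hat A$ of $A$ and $|\hat\phi_{BC}\rangle$ of the projectivization of $B \otimes C$. Let $c_{\hat a}, c_{\hat b\hat c} \in H^2(X_{BC};\mathbb{Z})$ be the obstructions (first Chern classes of the corresponding $\mathrm{U}(1)$-bundles of phases) to lifting $|\hat a\rangle$, respectively $|\hat\phi_{BC}\rangle$, to a nowhere vanishing section of $A|_{X_{BC}}$, respectively $(B \otimes C)|_{X_{BC}}$. One has $c_{\hat a} + c_{\hat b\hat c} = 0$. Define $c_{\hat b}, c_{\hat c\hat a} \in H^2(X_{CA};\mathbb{Z})$ and $c_{\hat c}, c_{\hat a\hat b} \in H^2(X_{AB};\mathbb{Z})$ analogously. The section $\Gamma$ is called untwisted if $\Gamma(x) \in V_2'$ for all $x$ and $c_{\hat a} = c_{\hat b\hat c} = 0$ on $X_{BC}$, $c_{\hat b} = c_{\hat c\hat a} = 0$ on $X_{CA}$, and $c_{\hat c} = c_{\hat a\hat b} = 0$ on $X_{AB}$. Equivalently, the factor $|\hat a\rangle$ lifts to a nowhere vanishing continuous section of $A$ over $X_{BC}$, $|\hat b\rangle$ to one of $B$ over $X_{CA}$, and $|\hat c\rangle$ to one of $C$ over $X_{AB}$. *)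

theory Defs
  imports "HOL-Analysis.Analysis"
begin

section \<open>Quaternionic projective space\<close>

text \<open>The pair \<open>(z, w)\<close> stands for the quaternion \<open>z + w j\<close>, where \<open>j z = cnj z j\<close> and \<open>j j = -1\<close>.
  Restricting the left multiplication to pairs \<open>(z, 0)\<close> gives the componentwise complex scaling.\<close>

type_synonym quaternion = "complex \<times> complex"

definition qmult :: "quaternion \<Rightarrow> quaternion \<Rightarrow> quaternion" where
  "qmult p q = (fst p * fst q - snd p * cnj (snd q), fst p * snd q + snd p * cnj (fst q))"

definition quaternionic_line :: "quaternion ^ 'n \<Rightarrow> (quaternion ^ 'n) set" where
  "quaternionic_line v = range (\<lambda>q. \<chi> k. qmult q (v $ k))"

text \<open>The quotient topology on the set of (left) quaternionic lines of the space of quaternionic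
  4-vectors.\<close>

definition HP3 :: "(quaternion ^ 4) set topology" where
  "HP3 = topology (\<lambda>\<U>. \<U> \<subseteq> quaternionic_line ` (- {0}) \<and>
                        open {v. v \<noteq> 0 \<and> quaternionic_line v \<in> \<U>})"

lemma openin_HP3:
  "openin HP3 \<U> \<longleftrightarrow> \<U> \<subseteq> quaternionic_line ` (- {0}) \<and>
                   open {v. v \<noteq> 0 \<and> quaternionic_line v \<in> \<U>}"
proof -
  have "istopology (\<lambda>\<U>. \<U> \<subseteq> quaternionic_line ` (- {0 :: quaternion ^ 4}) \<and>
                        open {v. v \<noteq> 0 \<and> quaternionic_line v \<in> \<U>})"
    unfolding istopology_def
  proof (intro conjI allI impI)
    fix S T :: "(quaternion ^ 4) set set"
    assume S: "S \<subseteq> quaternionic_line ` (- {0}) \<and> open {v. v \<noteq> 0 \<and> quaternionic_line v \<in> S}"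
      and T: "T \<subseteq> quaternionic_line ` (- {0}) \<and> open {v. v \<noteq> 0 \<and> quaternionic_line v \<in> T}"
    show "S \<inter> T \<subseteq> quaternionic_line ` (- {0})" using S by blast
    have "{v. v \<noteq> 0 \<and> quaternionic_line v \<in> S \<inter> T}
        = {v. v \<noteq> 0 \<and> quaternionic_line v \<in> S} \<inter> {v. v \<noteq> 0 \<and> quaternionic_line v \<in> T}" by blast
    then show "open {v. v \<noteq> 0 \<and> quaternionic_line v \<in> S \<inter> T}" using S T by (simp add: open_Int)
  next
    fix \<K> :: "(quaternion ^ 4) set set set"
    assume K: "\<forall>S\<in>\<K>. S \<subseteq> quaternionic_line ` (- {0}) \<and>
                     open {v. v \<noteq> 0 \<and> quaternionic_line v \<in> S}"
    show "\<Union>\<K> \<subseteq> quaternionic_line ` (- {0})" using K by blast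
    have "{v. v \<noteq> 0 \<and> quaternionic_line v \<in> \<Union>\<K>}
        = (\<Union>S\<in>\<K>. {v. v \<noteq> 0 \<and> quaternionic_line v \<in> S})" by blast
    then show "open {v. v \<noteq> 0 \<and> quaternionic_line v \<in> \<Union>\<K>}" using K by auto
  qed
  then show ?thesis by (simp add: HP3_def)
qed

lemma topspace_HP3: "topspace HP3 = quaternionic_line ` (- {0})"
proof -
  have "{v :: quaternion ^ 4. v \<noteq> 0 \<and> quaternionic_line v \<in> quaternionic_line ` (- {0})} = - {0}"
    by auto
  then have "openin HP3 (quaternionic_line ` (- {0}))"
    by (simp add: openin_HP3 open_Compl)
  from openin_subset[OF this] have "quaternionic_line ` (- {0}) \<subseteq> topspace HP3" .
  moreover have "topspace HP3 \<subseteq> quaternionic_line ` (- {0})"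
    using openin_topspace[of HP3] unfolding openin_HP3 by (rule conjunct1)
  ultimately show ?thesis by (rule subset_antisym[rotated])
qed

lemma quotient_map_HP3:
  "quotient_map (top_of_set (- {0})) HP3 quaternionic_line"
proof -
  have "{v. v \<noteq> 0 \<and> quaternionic_line v \<in> U} = {v \<in> - {0}. quaternionic_line v \<in> U}"
    for U :: "(quaternion ^ 4) set set" by auto
  then show ?thesis
    by (auto simp: quotient_map_def topspace_HP3 openin_HP3 openin_open_eq open_Compl)
qed

section \<open>Vector bundles and tensor products\<close>

text \<open>A bundle over a base with points in \<open>'x\<close> is given as a subbundle of a trivial bundle with fibre
  \<open>complex ^ 'n\<close>, i.e. as a family of complex subspaces, with the topology of the total space
  induced from the trivial bundle. Sections are thus continuous maps into \<open>complex ^ 'n\<close>, and the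
  Hermitian metric of \<open>complex ^ 'n\<close> provides the unitary structure.\<close>

type_synonym ('x, 'n) subbundle = "'x \<Rightarrow> (complex ^ 'n) set"

definition complex_coords :: "quaternion ^ 'n \<Rightarrow> complex ^ ('n \<times> 2)" where
  "complex_coords v = (\<chi> p. if snd p = 1 then fst (v $ fst p) else snd (v $ fst p))"

text \<open>The fibre over a quaternionic line is the line itself, as a complex vector space.\<close>

definition canonical_bundle :: "((quaternion ^ 4) set, 4 \<times> 2) subbundle" where
  "canonical_bundle L = complex_coords ` L"

definition tensor :: "complex ^ 'i \<Rightarrow> complex ^ 'j \<Rightarrow> complex ^ ('i \<times> 'j)" where
  "tensor a b = (\<chi> p. a $ fst p * b $ snd p)"

definition tensor_space ::
    "(complex ^ 'i) set \<Rightarrow> (complex ^ 'j) set \<Rightarrow> (complex ^ ('i \<times> 'j)) set" where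
  "tensor_space A B = vec.span {tensor a b | a b. a \<in> A \<and> b \<in> B}"

definition tensor_bundle ::
    "('x, 'i::finite) subbundle \<Rightarrow> ('x, 'j::finite) subbundle \<Rightarrow> ('x, 'i \<times> 'j) subbundle" where
  "tensor_bundle A B x = tensor_space (A x) (B x)"

definition continuous_section ::
    "'x topology \<Rightarrow> ('x, 'n::finite) subbundle \<Rightarrow> ('x \<Rightarrow> complex ^ 'n) \<Rightarrow> bool" where
  "continuous_section X E \<sigma> \<longleftrightarrow>
     continuous_map X euclidean \<sigma> \<and> (\<forall>x\<in>topspace X. \<sigma> x \<in> E x)"

text \<open>The isomorphism of \<open>A \<otimes> (B \<otimes> C)\<close> with \<open>B \<otimes> (C \<otimes> A)\<close>.\<close>

definition rotate_factors ::
    "complex ^ ('i::finite \<times> 'j::finite \<times> 'k::finite) \<Rightarrow> complex ^ ('j \<times> 'k \<times> 'i)" where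
  "rotate_factors v = (\<chi> p. v $ (snd (snd p), fst p, fst (snd p)))"

section \<open>Second integral Cech cohomology\<close>

text \<open>Covers are indexed by their own members. Cochains have values in the constant sheaf of integers;
  the values of \<open>m U V\<close> and \<open>n U V W\<close> matter only on \<open>U \<inter> V\<close> and \<open>U \<inter> V \<inter> W\<close>. The cohomology is the
  direct limit over open covers, ordered by refinement.\<close>

type_synonym 'x cochain1 = "'x set \<Rightarrow> 'x set \<Rightarrow> 'x \<Rightarrow> int"
type_synonym 'x cochain2 = "'x set \<Rightarrow> 'x set \<Rightarrow> 'x set \<Rightarrow> 'x \<Rightarrow> int"

definition open_cover :: "'x topology \<Rightarrow> 'x set set \<Rightarrow> bool" where
  "open_cover X \<U> \<longleftrightarrow> (\<forall>U\<in>\<U>. openin X U) \<and> \<Union>\<U> = topspace X"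

definition locally_const_on :: "'x topology \<Rightarrow> 'x set \<Rightarrow> ('x \<Rightarrow> int) \<Rightarrow> bool" where
  "locally_const_on X S f \<longleftrightarrow> continuous_map (subtopology X S) (discrete_topology UNIV) f"

definition is_cochain1 :: "'x topology \<Rightarrow> 'x set set \<Rightarrow> 'x cochain1 \<Rightarrow> bool" where
  "is_cochain1 X \<U> m \<longleftrightarrow> (\<forall>U\<in>\<U>. \<forall>V\<in>\<U>. locally_const_on X (U \<inter> V) (m U V))"

definition coboundary1 :: "'x cochain1 \<Rightarrow> 'x cochain2" where
  "coboundary1 m U V W x = m V W x - m U W x + m U V x"

definition cech_Z2 :: "'x topology \<Rightarrow> ('x set set \<times> 'x cochain2) set" where
  "cech_Z2 X = {(\<U>, n). open_cover X \<U> \<and>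
     (\<forall>U\<in>\<U>. \<forall>V\<in>\<U>. \<forall>W\<in>\<U>. locally_const_on X (U \<inter> V \<inter> W) (n U V W)) \<and>
     (\<forall>T\<in>\<U>. \<forall>U\<in>\<U>. \<forall>V\<in>\<U>. \<forall>W\<in>\<U>. \<forall>x\<in>T \<inter> U \<inter> V \<inter> W.
        n U V W x - n T V W x + n T U W x - n T U V x = 0)}"

definition refinement_map :: "'x set set \<Rightarrow> 'x set set \<Rightarrow> ('x set \<Rightarrow> 'x set) \<Rightarrow> bool" where
  "refinement_map \<W> \<U> r \<longleftrightarrow> (\<forall>W\<in>\<W>. r W \<in> \<U> \<and> W \<subseteq> r W)"

definition cech_rel ::
    "'x topology \<Rightarrow> (('x set set \<times> 'x cochain2) \<times> ('x set set \<times> 'x cochain2)) set" where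
  "cech_rel X = {((\<U>, n), (\<V>, k)). (\<U>, n) \<in> cech_Z2 X \<and> (\<V>, k) \<in> cech_Z2 X \<and>
     (\<exists>\<W> r s m. open_cover X \<W> \<and> refinement_map \<W> \<U> r \<and> refinement_map \<W> \<V> s \<and>
        is_cochain1 X \<W> m \<and>
        (\<forall>U\<in>\<W>. \<forall>V\<in>\<W>. \<forall>W\<in>\<W>. \<forall>x\<in>U \<inter> V \<inter> W.
           n (r U) (r V) (r W) x - k (s U) (s V) (s W) x = coboundary1 m U V W x))}"

definition cech_H2 :: "'x topology \<Rightarrow> ('x set set \<times> 'x cochain2) set set" where
  "cech_H2 X = cech_Z2 X // cech_rel X"

definition cech_H2_zero :: "'x topology \<Rightarrow> ('x set set \<times> 'x cochain2) set" where
  "cech_H2_zero X = cech_rel X `` {({topspace X}, \<lambda>U V W x. 0)}"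

lemma locally_const_on_mono:
  "locally_const_on X S f \<Longrightarrow> T \<subseteq> S \<Longrightarrow> locally_const_on X T f"
  unfolding locally_const_on_def by (rule continuous_map_from_subtopology_mono)

lemma locally_const_on_binop:
  assumes "locally_const_on X S f" "locally_const_on X S g"
  shows "locally_const_on X S (\<lambda>x. h (f x) (g x))"
proof -
  have "continuous_map (subtopology X S)
      (prod_topology (discrete_topology UNIV) (discrete_topology UNIV)) (\<lambda>x. (f x, g x))"
    using assms by (simp add: locally_const_on_def continuous_map_pairedI)
  moreover have "prod_topology (discrete_topology UNIV) (discrete_topology UNIV)
      = (discrete_topology (UNIV :: (int \<times> int) set))"
    by (metis UNIV_Times_UNIV prod_topology_discrete_topology)
  ultimately have "continuous_map (subtopology X S) (discrete_topology UNIV) (\<lambda>x. (f x, g x))"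
    by simp
  then have "continuous_map (subtopology X S) (discrete_topology UNIV) (case_prod h \<circ> (\<lambda>x. (f x, g x)))"
    by (rule continuous_map_compose) simp
  then show ?thesis by (simp add: locally_const_on_def o_def)
qed

lemma locally_const_on_add:
    "locally_const_on X S f \<Longrightarrow> locally_const_on X S g \<Longrightarrow> locally_const_on X S (\<lambda>x. f x + g x)"
  and locally_const_on_diff:
    "locally_const_on X S f \<Longrightarrow> locally_const_on X S g \<Longrightarrow> locally_const_on X S (\<lambda>x. f x - g x)"
  by (rule locally_const_on_binop; assumption)+

lemma cech_relI:
  assumes "(\<U>, n) \<in> cech_Z2 X" "(\<V>, k) \<in> cech_Z2 X" "open_cover X \<W>"
    "refinement_map \<W> \<U> r" "refinement_map \<W> \<V> s" "is_cochain1 X \<W> m"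
    "\<And>U V W x. U \<in> \<W> \<Longrightarrow> V \<in> \<W> \<Longrightarrow> W \<in> \<W> \<Longrightarrow> x \<in> U \<inter> V \<inter> W \<Longrightarrow>
       n (r U) (r V) (r W) x - k (s U) (s V) (s W) x = coboundary1 m U V W x"
  shows "((\<U>, n), (\<V>, k)) \<in> cech_rel X"
  unfolding cech_rel_def mem_Collect_eq case_prod_conv
  by (intro conjI exI[of _ \<W>] exI[of _ r] exI[of _ s] exI[of _ m] ballI assms)

lemma equiv_cech_rel: "equiv (cech_Z2 X) (cech_rel X)"
proof (rule equivI)
  show "cech_rel X \<subseteq> cech_Z2 X \<times> cech_Z2 X" by (auto simp: cech_rel_def)
  show "refl_on (cech_Z2 X) (cech_rel X)"
  proof (rule refl_onI)
    fix p assume "p \<in> cech_Z2 X"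
    then obtain \<U> n where p: "p = (\<U>, n)" "(\<U>, n) \<in> cech_Z2 X" by (cases p) auto
    have "open_cover X \<U>" using p(2) by (simp add: cech_Z2_def)
    moreover have "refinement_map \<U> \<U> id" by (simp add: refinement_map_def)
    moreover have "is_cochain1 X \<U> (\<lambda>U V x. 0)" by (simp add: is_cochain1_def locally_const_on_def)
    ultimately show "(p, p) \<in> cech_rel X" unfolding p(1) using p(2)
      by (auto simp: cech_rel_def coboundary1_def intro!: exI[of _ \<U>] exI[of _ id]
          exI[of _ "\<lambda>U V x. 0"])
  qed
  show "sym (cech_rel X)"
  proof (rule symI)
    fix p q assume pq: "(p, q) \<in> cech_rel X"
    obtain \<U> n where p: "p = (\<U>, n)" by (cases p)
    obtain \<V> k where q: "q = (\<V>, k)" by (cases q)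
    note pqeq = p q
    from pq obtain \<W> r s m where h: "(\<U>, n) \<in> cech_Z2 X" "(\<V>, k) \<in> cech_Z2 X" "open_cover X \<W>"
      "refinement_map \<W> \<U> r" "refinement_map \<W> \<V> s" "is_cochain1 X \<W> m"
      and e: "\<forall>U\<in>\<W>. \<forall>V\<in>\<W>. \<forall>W\<in>\<W>. \<forall>x\<in>U \<inter> V \<inter> W.
           n (r U) (r V) (r W) x - k (s U) (s V) (s W) x = coboundary1 m U V W x"
      unfolding pqeq cech_rel_def mem_Collect_eq case_prod_conv
      by (elim conjE exE) (rule that; assumption)
    define m' where "m' = (\<lambda>U V x. 0 - m U V x)"
    have c: "is_cochain1 X \<W> m'" using h(6) unfolding is_cochain1_def m'_def
      by (intro ballI locally_const_on_diff) (auto simp: locally_const_on_def)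
    have e': "k (s U) (s V) (s W) x - n (r U) (r V) (r W) x = coboundary1 m' U V W x"
      if "U\<in>\<W>" "V\<in>\<W>" "W\<in>\<W>" "x\<in>U \<inter> V \<inter> W" for U V W x
      using e[rule_format, OF that] by (simp add: coboundary1_def m'_def)
    show "(q, p) \<in> cech_rel X" unfolding pqeq
      by (rule cech_relI[where r = s and s = r and m = m' and \<W> = \<W>]) (fact h c e' | (rule e'; assumption))+
  qed
  show "trans (cech_rel X)"
  proof (rule transI)
    fix p q o' assume pq: "(p, q) \<in> cech_rel X" and qo: "(q, o') \<in> cech_rel X"
    obtain \<U> n where p: "p = (\<U>, n)" by (cases p)
    obtain \<V> k where q: "q = (\<V>, k)" by (cases q)
    obtain \<Y> l where o': "o' = (\<Y>, l)" by (cases o')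
    note eqs = p q o'
    from pq obtain \<W>1 r1 s1 m1 where h1: "(\<U>, n) \<in> cech_Z2 X" "(\<V>, k) \<in> cech_Z2 X"
      "open_cover X \<W>1" "refinement_map \<W>1 \<U> r1" "refinement_map \<W>1 \<V> s1" "is_cochain1 X \<W>1 m1"
      and e1: "\<forall>U\<in>\<W>1. \<forall>V\<in>\<W>1. \<forall>W\<in>\<W>1. \<forall>x\<in>U \<inter> V \<inter> W.
           n (r1 U) (r1 V) (r1 W) x - k (s1 U) (s1 V) (s1 W) x = coboundary1 m1 U V W x"
      unfolding eqs cech_rel_def mem_Collect_eq case_prod_conv
      by (elim conjE exE) (rule that; assumption)
    from qo obtain \<W>2 r2 s2 m2 where h2: "(\<Y>, l) \<in> cech_Z2 X"
      "open_cover X \<W>2" "refinement_map \<W>2 \<V> r2" "refinement_map \<W>2 \<Y> s2" "is_cochain1 X \<W>2 m2"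
      and e2: "\<forall>U\<in>\<W>2. \<forall>V\<in>\<W>2. \<forall>W\<in>\<W>2. \<forall>x\<in>U \<inter> V \<inter> W.
           k (r2 U) (r2 V) (r2 W) x - l (s2 U) (s2 V) (s2 W) x = coboundary1 m2 U V W x"
      unfolding eqs cech_rel_def mem_Collect_eq case_prod_conv
      by (elim conjE exE) (rule that; assumption)
    define \<W> where "\<W> = {A \<inter> B | A B. A \<in> \<W>1 \<and> B \<in> \<W>2}"
    have cov: "open_cover X \<W>" using h1(3) h2(2) unfolding open_cover_def \<W>_def by blast
    have "\<forall>W\<in>\<W>. \<exists>A B. A \<in> \<W>1 \<and> B \<in> \<W>2 \<and> W \<subseteq> A \<and> W \<subseteq> B" unfolding \<W>_def by blast
    then obtain t1 t2 where t: "\<And>W. W\<in>\<W> \<Longrightarrow> t1 W \<in> \<W>1 \<and> t2 W \<in> \<W>2 \<and> W \<subseteq> t1 W \<and> W \<subseteq> t2 W"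
      by metis
    define a b where "a = s1 \<circ> t1" and "b = r2 \<circ> t2"
    have ab: "a W \<in> \<V>" "b W \<in> \<V>" "W \<subseteq> a W" "W \<subseteq> b W" if "W \<in> \<W>" for W
      using t[OF that] h1(5) h2(3) unfolding a_def b_def refinement_map_def by fastforce+
    have kl: "locally_const_on X (U \<inter> V \<inter> W) (k U V W)" if "U \<in> \<V>" "V \<in> \<V>" "W \<in> \<V>" for U V W
      using h1(2) that by (auto simp: cech_Z2_def)
    have kc: "k U V W x - k T V W x + k T U W x - k T U V x = 0"
      if "T \<in> \<V>" "U \<in> \<V>" "V \<in> \<V>" "W \<in> \<V>" "x \<in> T \<inter> U \<inter> V \<inter> W" for T U V W x
      using h1(2) that by (auto simp: cech_Z2_def)
    define h where "h = (\<lambda>U V x. k (a U) (a V) (b V) x - k (a U) (b U) (b V) x)"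
    define m where "m = (\<lambda>U V x. (m1 (t1 U) (t1 V) x + m2 (t2 U) (t2 V) x) + h U V x)"
    have "locally_const_on X (U \<inter> V) (h U V)" if "U \<in> \<W>" "V \<in> \<W>" for U V
      unfolding h_def
      by (intro locally_const_on_diff locally_const_on_mono[OF kl]) (use ab[OF that(1)] ab[OF that(2)] in auto)
    moreover have "locally_const_on X (U \<inter> V) (m1 (t1 U) (t1 V))" if "U \<in> \<W>" "V \<in> \<W>" for U V
      by (rule locally_const_on_mono[where S = "t1 U \<inter> t1 V"])
        (use h1(6) t[OF that(1)] t[OF that(2)] in \<open>auto simp: is_cochain1_def\<close>)
    moreover have "locally_const_on X (U \<inter> V) (m2 (t2 U) (t2 V))" if "U \<in> \<W>" "V \<in> \<W>" for U V
      by (rule locally_const_on_mono[where S = "t2 U \<inter> t2 V"])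
        (use h2(5) t[OF that(1)] t[OF that(2)] in \<open>auto simp: is_cochain1_def\<close>)
    ultimately have mc: "is_cochain1 X \<W> m"
      unfolding is_cochain1_def m_def by (intro ballI locally_const_on_add) auto
    have me: "n ((r1 \<circ> t1) U) ((r1 \<circ> t1) V) ((r1 \<circ> t1) W) x
        - l ((s2 \<circ> t2) U) ((s2 \<circ> t2) V) ((s2 \<circ> t2) W) x = coboundary1 m U V W x"
      if "U\<in>\<W>" "V\<in>\<W>" "W\<in>\<W>" "x\<in>U \<inter> V \<inter> W" for U V W x
    proof -
      have x: "x \<in> U" "x \<in> V" "x \<in> W" using that by auto
      note tt = t[OF that(1)] t[OF that(2)] t[OF that(3)]
      note aa = ab[OF that(1)] ab[OF that(2)] ab[OF that(3)]
      have 1: "n (r1 (t1 U)) (r1 (t1 V)) (r1 (t1 W)) x - k (a U) (a V) (a W) x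
          = coboundary1 m1 (t1 U) (t1 V) (t1 W) x"
        unfolding a_def o_def by (rule e1[rule_format]) (use tt x in auto)
      have 2: "k (b U) (b V) (b W) x - l (s2 (t2 U)) (s2 (t2 V)) (s2 (t2 W)) x
          = coboundary1 m2 (t2 U) (t2 V) (t2 W) x"
        unfolding b_def o_def by (rule e2[rule_format]) (use tt x in auto)
      have 3: "k (a V) (a W) (b W) x - k (a U) (a W) (b W) x + k (a U) (a V) (b W) x
          - k (a U) (a V) (a W) x = 0" by (rule kc) (use aa x in auto)
      have 4: "k (a V) (b V) (b W) x - k (a U) (b V) (b W) x + k (a U) (a V) (b W) x
          - k (a U) (a V) (b V) x = 0" by (rule kc) (use aa x in auto)
      have 5: "k (b U) (b V) (b W) x - k (a U) (b V) (b W) x + k (a U) (b U) (b W) x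
          - k (a U) (b U) (b V) x = 0" by (rule kc) (use aa x in auto)
      show ?thesis using 1 2 3 4 5 unfolding coboundary1_def m_def h_def o_def by linarith
    qed
    have ref: "refinement_map \<W> \<U> (r1 \<circ> t1)" "refinement_map \<W> \<Y> (s2 \<circ> t2)"
      using t h1(4) h2(4) unfolding refinement_map_def by fastforce+
    show "(p, o') \<in> cech_rel X"
      unfolding eqs
      by (rule cech_relI[OF h1(1) h2(1) cov ref mc], (rule me; assumption))
  qed
qed

section \<open>The first Chern class of a projective section\<close>

text \<open>A projective section is a family \<open>L\<close> of complex lines. Its \<open>U(1)\<close>-bundle of phases consists of
  the unit vectors of these lines. Given local sections \<open>s U\<close> of it over a cover, with transition
  functions \<open>exp (2 \<pi> \<i> \<phi> U V)\<close>, the first Chern class is represented by the integral coboundary of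
  the real cochain \<open>\<phi>\<close> (the connecting homomorphism of the exponential sequence).\<close>

definition is_chern_cocycle ::
    "'x topology \<Rightarrow> ('x, 'n::finite) subbundle \<Rightarrow> 'x set set \<Rightarrow> 'x cochain2 \<Rightarrow> bool" where
  "is_chern_cocycle X L \<U> n \<longleftrightarrow> (\<U>, n) \<in> cech_Z2 X \<and> (\<exists>s \<phi>.
     (\<forall>U\<in>\<U>. continuous_section (subtopology X U) L (s U) \<and> (\<forall>x\<in>U. norm (s U x) = 1)) \<and>
     (\<forall>U\<in>\<U>. \<forall>V\<in>\<U>. continuous_map (subtopology X (U \<inter> V)) euclideanreal (\<phi> U V) \<and>
        (\<forall>x\<in>U \<inter> V. s V x = cis (2 * pi * \<phi> U V x) *s s U x)) \<and>
     (\<forall>U\<in>\<U>. \<forall>V\<in>\<U>. \<forall>W\<in>\<U>. \<forall>x\<in>U \<inter> V \<inter> W.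
        real_of_int (n U V W x) = \<phi> V W x - \<phi> U W x + \<phi> U V x))"

definition first_chern_class ::
    "'x topology \<Rightarrow> ('x, 'n::finite) subbundle \<Rightarrow> ('x set set \<times> 'x cochain2) set" where
  "first_chern_class X L = cech_rel X `` {(\<U>, n). is_chern_cocycle X L \<U> n}"

section \<open>Entanglement types and untwisted sections\<close>

text \<open>Type \<open>A-BC\<close> (overlined). The two other types arise by cyclic rotation of the factors.\<close>

definition splits_first ::
    "(complex ^ 'i) set \<Rightarrow> (complex ^ 'j) set \<Rightarrow> (complex ^ 'k) set
      \<Rightarrow> complex ^ ('i::finite \<times> 'j::finite \<times> 'k::finite) \<Rightarrow> bool" where
  "splits_first A B C v \<longleftrightarrow> v \<noteq> 0 \<and> (\<exists>a\<in>A. \<exists>\<phi>\<in>tensor_space B C. v = tensor a \<phi>)"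

definition V2' ::
    "(complex ^ 'i) set \<Rightarrow> (complex ^ 'j) set \<Rightarrow> (complex ^ 'k) set
      \<Rightarrow> (complex ^ ('i::finite \<times> 'j::finite \<times> 'k::finite)) set" where
  "V2' A B C = {v \<in> tensor_space A (tensor_space B C). v \<noteq> 0 \<and>
     (splits_first A B C v \<or>
      splits_first B C A (rotate_factors v) \<or>
      splits_first C A B (rotate_factors (rotate_factors v)))}"

definition splitting_locus ::
    "'x topology \<Rightarrow> ('x, 'i::finite) subbundle \<Rightarrow> ('x, 'j::finite) subbundle \<Rightarrow> ('x, 'k::finite) subbundle
      \<Rightarrow> ('x \<Rightarrow> complex ^ ('i \<times> 'j \<times> 'k)) \<Rightarrow> 'x set" where
  "splitting_locus X A B C \<Gamma> = {x \<in> topspace X. splits_first (A x) (B x) (C x) (\<Gamma> x)}"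

text \<open>On the splitting locus, where \<open>\<Gamma> = a \<otimes> \<phi>\<close>, these are the complex lines spanned by \<open>a\<close> and
  by \<open>\<phi>\<close>.\<close>

definition first_factor ::
    "('x, 'i::finite) subbundle \<Rightarrow> ('x, 'j::finite) subbundle \<Rightarrow> ('x, 'k::finite) subbundle
      \<Rightarrow> ('x \<Rightarrow> complex ^ ('i \<times> 'j \<times> 'k)) \<Rightarrow> ('x, 'i) subbundle" where
  "first_factor A B C \<Gamma> x = insert 0 {a \<in> A x. \<exists>\<phi>\<in>tensor_bundle B C x. \<Gamma> x = tensor a \<phi>}"

definition remaining_factor ::
    "('x, 'i::finite) subbundle \<Rightarrow> ('x, 'j::finite) subbundle \<Rightarrow> ('x, 'k::finite) subbundle
      \<Rightarrow> ('x \<Rightarrow> complex ^ ('i \<times> 'j \<times> 'k)) \<Rightarrow> ('x, 'j \<times> 'k) subbundle" where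
  "remaining_factor A B C \<Gamma> x = insert 0 {\<phi> \<in> tensor_bundle B C x. \<exists>a\<in>A x. \<Gamma> x = tensor a \<phi>}"

definition untwisted_first ::
    "'x topology \<Rightarrow> ('x, 'i::finite) subbundle \<Rightarrow> ('x, 'j::finite) subbundle \<Rightarrow> ('x, 'k::finite) subbundle
      \<Rightarrow> ('x \<Rightarrow> complex ^ ('i \<times> 'j \<times> 'k)) \<Rightarrow> bool" where
  "untwisted_first X A B C \<Gamma> \<longleftrightarrow>
     (let Y = subtopology X (splitting_locus X A B C \<Gamma>) in
        first_chern_class Y (first_factor A B C \<Gamma>) = cech_H2_zero Y \<and>
        first_chern_class Y (remaining_factor A B C \<Gamma>) = cech_H2_zero Y)"

definition untwisted ::
    "'x topology \<Rightarrow> ('x, 'i::finite) subbundle \<Rightarrow> ('x, 'j::finite) subbundle \<Rightarrow> ('x, 'k::finite) subbundle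
      \<Rightarrow> ('x \<Rightarrow> complex ^ ('i \<times> 'j \<times> 'k)) \<Rightarrow> bool" where
  "untwisted X A B C \<Gamma> \<longleftrightarrow>
     (\<forall>x\<in>topspace X. \<Gamma> x \<in> V2' (A x) (B x) (C x)) \<and>
     untwisted_first X A B C \<Gamma> \<and>
     untwisted_first X B C A (rotate_factors \<circ> \<Gamma>) \<and>
     untwisted_first X C A B (rotate_factors \<circ> rotate_factors \<circ> \<Gamma>)"

end

theory Submission
  imports Defs "HOL-Homology.Brouwer_Degree"
begin

text \<open>Since its Chern class vanishes, the first factor lifts to a nowhere vanishing section of the
  canonical bundle over the splitting locus. The fibre over the line of a unit vector \<open>v\<close> consists of
  the quaternionic multiples of \<open>v\<close>, so a section is \<open>f v * v\<close> for a quaternion-valued function \<open>f\<close>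
  with \<open>f (- v) = - f v\<close>. By Tietze, the functions for the three splitting loci extend to odd maps
  on the 15-sphere. As the loci cover the base, these have no common zero, and together they form an
  odd map from the 15-sphere to a space of real dimension 12 without zeros, contradicting the
  Borsuk-Ulam theorem.\<close>

section \<open>The Borsuk-Ulam theorem\<close>

text \<open>Nowhere jointly vanishing extensions of the three lifts would form a nowhere zero
  section of the direct sum of \<open>A\<close>, \<open>B\<close> and \<open>C\<close>, whose Euler
  class is the cube of the generator of H^4(HP^3) and generates H^12(HP^3). Borsuk-Ulam stands in
  for this computation: the coefficient of a section satisfies f (q v) = f v * inverse q for unit
  quaternions q, and only q = -1 is retained. Antisymmetrising restores this weaker symmetry after
  the Tietze extension, and it suffices because 12 is at most 15. The obstacle is to turn a
  vanishing Cech class, taken on a subspace of a quotient space, into an actual lift. The gluing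
  takes place on the compact preimage of the locus in the sphere, so that the quotient topology
  enters only through continuity of the projection. The partition of unity is made invariant under
  the antipode; the lift is then constant on antipodal pairs, and this is what makes its coefficient
  odd.\<close>

lemma simplicial_vertex_singular_face:
  assumes "k \<le> p" "i < p"
  shows "simplicial_vertex i (singular_face p k f)
       = simplicial_vertex (if i < k then i else Suc i) f"
proof -
  have "simplical_face k (\<lambda>j. if j = i then 1 else 0::real)
      = (\<lambda>j. if j = (if i < k then i else Suc i) then 1 else 0)"
    by (auto simp: simplical_face_def fun_eq_iff)
  then show ?thesis
    using assms by (auto simp: simplicial_vertex_def singular_face_def)
qed

lemma simplicial_vertex_simplex_map:
  "i \<le> p \<Longrightarrow> simplicial_vertex i (simplex_map p g f) = g (simplicial_vertex i f)"
  by (simp add: simplicial_vertex_def simplex_map_def)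

text \<open>The pairing of a cochain with a chain, encoded as the linear extension into the free
  abelian group on one point followed by reading off its coefficient. Linearity is thus inherited
  from \<open>frag_extend\<close>.\<close>

definition cochain_eval :: "('b \<Rightarrow> int) \<Rightarrow> ('b \<Rightarrow>\<^sub>0 int) \<Rightarrow> int" where
  "cochain_eval F c = Poly_Mapping.lookup (frag_extend (\<lambda>f. frag_cmul (F f) (frag_of ())) c) ()"

lemma cochain_eval_0 [simp]: "cochain_eval F 0 = 0"
  by (simp add: cochain_eval_def)

lemma cochain_eval_of [simp]: "cochain_eval F (frag_of f) = F f"
  by (simp add: cochain_eval_def)

lemma cochain_eval_add: "cochain_eval F (a + b) = cochain_eval F a + cochain_eval F b"
  by (simp add: cochain_eval_def frag_extend_add lookup_add)

lemma cochain_eval_diff: "cochain_eval F (a - b) = cochain_eval F a - cochain_eval F b"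
  by (simp add: cochain_eval_def frag_extend_diff lookup_minus)

lemma cochain_eval_cmul: "cochain_eval F (frag_cmul k c) = k * cochain_eval F c"
  by (simp add: cochain_eval_def frag_extend_cmul)

lemma cochain_eval_sum:
  "finite I \<Longrightarrow> cochain_eval F (\<Sum>i\<in>I. g i) = (\<Sum>i\<in>I. cochain_eval F (g i))"
  by (induction I rule: finite_induct) (simp_all add: cochain_eval_add)

lemma cochain_eval_nonzeroE:
  assumes "cochain_eval F c \<noteq> 0"
  obtains f where "f \<in> Poly_Mapping.keys c" "F f \<noteq> 0"
proof -
  have "\<exists>f\<in>Poly_Mapping.keys c. F f \<noteq> 0"
  proof (rule ccontr)
    assume "\<not> (\<exists>f\<in>Poly_Mapping.keys c. F f \<noteq> 0)"
    then have "cochain_eval F c = 0"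
      unfolding cochain_eval_def by (subst frag_extend_eq_0) auto
    with assms show False by simp
  qed
  then show ?thesis using that by blast
qed

text \<open>The Alexander-Whitney formula for the simplex with vertices \<open>v 0, \<dots>, v k\<close>.\<close>

definition cup_coboundaries :: "(nat \<Rightarrow> 'a \<Rightarrow> int) \<Rightarrow> nat \<Rightarrow> (nat \<Rightarrow> 'a) \<Rightarrow> int" where
  "cup_coboundaries b k v = (\<Prod>i<k. b i (v (Suc i)) - b i (v i))"

lemma cup_coboundaries_0 [simp]: "cup_coboundaries b 0 v = 1"
  by (simp add: cup_coboundaries_def)

lemma cup_coboundaries_Suc:
  "cup_coboundaries b (Suc k) v = cup_coboundaries b k v * (b k (v (Suc k)) - b k (v k))"
  by (simp add: cup_coboundaries_def)

lemma cup_coboundaries_cong: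
  "(\<And>i. i \<le> k \<Longrightarrow> v i = w i) \<Longrightarrow> cup_coboundaries b k v = cup_coboundaries b k w"
  by (simp add: cup_coboundaries_def)

text \<open>The face operator on vertex sequences. It reduces coboundaries on singular simplices to
  finite sums over sequences.\<close>

definition skip_vertex :: "nat \<Rightarrow> (nat \<Rightarrow> 'a) \<Rightarrow> nat \<Rightarrow> 'a" where
  "skip_vertex j v i = (if i < j then v i else v (Suc i))"

text \<open>The cocycle identity with the last face moved to the right: omitting vertex
  \<open>Suc k\<close> leaves the vertices up to \<open>k\<close> unchanged. In the induction step
  the two differences of \<open>b k\<close> ending at \<open>v (Suc (Suc k))\<close> combine to the
  one between \<open>v k\<close> and \<open>v (Suc k)\<close>.\<close>

lemma cup_coboundaries_cocycle:
  "(\<Sum>j\<le>k. (- 1) ^ j * cup_coboundaries b k (skip_vertex j v)) = (- 1) ^ k * cup_coboundaries b k v"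
proof (induction k)
  case (Suc k)
  let ?W = "cup_coboundaries b k"
  have 1: "cup_coboundaries b (Suc k) (skip_vertex j v)
      = ?W (skip_vertex j v) * (b k (v (Suc (Suc k))) - b k (v (Suc k)))" if "j \<le> k" for j
    using that by (simp add: cup_coboundaries_Suc skip_vertex_def)
  have 2: "cup_coboundaries b (Suc k) (skip_vertex (Suc k) v)
      = ?W v * (b k (v (Suc (Suc k))) - b k (v k))"
    by (simp add: cup_coboundaries_Suc skip_vertex_def cup_coboundaries_cong[of k "skip_vertex (Suc k) v" v])
  have "(\<Sum>j\<le>Suc k. (- 1) ^ j * cup_coboundaries b (Suc k) (skip_vertex j v))
      = (\<Sum>j\<le>k. (- 1) ^ j * ?W (skip_vertex j v)) * (b k (v (Suc (Suc k))) - b k (v (Suc k)))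
        + (- 1) ^ Suc k * (?W v * (b k (v (Suc (Suc k))) - b k (v k)))"
    by (simp add: 1 2 sum_distrib_right mult.assoc)
  then show ?case
    by (simp add: Suc.IH cup_coboundaries_Suc algebra_simps)
qed simp

text \<open>Leibniz rule: the cup product is a cocycle, so only \<open>b k\<close> is
  differentiated, which supplies the next factor.\<close>

lemma coboundary_cup_coboundaries:
  fixes b :: "nat \<Rightarrow> 'a \<Rightarrow> int"
  defines "F \<equiv> \<lambda>k v. cup_coboundaries b k v * b k (v k)"
  shows "(\<Sum>j\<le>Suc k. (- 1) ^ j * F k (skip_vertex j v)) = (- 1) ^ k * cup_coboundaries b (Suc k) v"
proof -
  let ?W = "cup_coboundaries b k"
  have 1: "F k (skip_vertex j v) = ?W (skip_vertex j v) * b k (v (Suc k))" if "j \<le> k" for j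
    using that by (simp add: F_def skip_vertex_def)
  have 2: "F k (skip_vertex (Suc k) v) = ?W v * b k (v k)"
    by (simp add: F_def skip_vertex_def cup_coboundaries_cong[of k "skip_vertex (Suc k) v" v])
  have "(\<Sum>j\<le>Suc k. (- 1) ^ j * F k (skip_vertex j v))
      = (\<Sum>j\<le>k. (- 1) ^ j * ?W (skip_vertex j v)) * b k (v (Suc k)) + (- 1) ^ Suc k * (?W v * b k (v k))"
    by (simp add: 1 2 sum_distrib_right mult.assoc)
  then show ?thesis
    by (simp add: cup_coboundaries_cocycle cup_coboundaries_Suc algebra_simps)
qed

abbreviation vertices :: "((nat \<Rightarrow> real) \<Rightarrow> 'a) \<Rightarrow> nat \<Rightarrow> 'a" where
  "vertices f \<equiv> (\<lambda>i. simplicial_vertex i f)"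

lemma cochain_eval_chain_boundary_cup:
  fixes b :: "nat \<Rightarrow> 'a \<Rightarrow> int"
  defines "F \<equiv> \<lambda>k v. cup_coboundaries b k v * b k (v k)"
  shows "cochain_eval (\<lambda>f. F k (vertices f)) (chain_boundary (Suc k) c)
       = (- 1) ^ k * cochain_eval (\<lambda>f. cup_coboundaries b (Suc k) (vertices f)) c"
  using subset_UNIV
proof (induction c rule: frag_induction)
  case (one f)
  have "F k (vertices (singular_face (Suc k) j f)) = F k (skip_vertex j (vertices f))"
    if "j \<le> Suc k" for j
    unfolding F_def using that
    by (intro arg_cong2[where f = "(*)"] cup_coboundaries_cong)
       (auto simp: simplicial_vertex_singular_face skip_vertex_def)
  then have "cochain_eval (\<lambda>f. F k (vertices f)) (chain_boundary (Suc k) (frag_of f))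
      = (\<Sum>j\<le>Suc k. (- 1) ^ j * F k (skip_vertex j (vertices f)))"
    by (simp add: chain_boundary_of cochain_eval_sum cochain_eval_cmul cochain_eval_add)
  also have "\<dots> = (- 1) ^ k * cup_coboundaries b (Suc k) (vertices f)"
    unfolding F_def by (rule coboundary_cup_coboundaries)
  finally show ?case by simp
next
  case (diff a b)
  then show ?case by (simp add: chain_boundary_diff cochain_eval_diff algebra_simps)
qed simp

text \<open>Replacing each \<open>b i\<close> by \<open>1 - b i\<close> changes the sign of all
  \<open>k\<close> coboundary factors and turns the last factor into \<open>1 - b k\<close>; its two
  summands are the two terms on the right.\<close>

lemma cochain_eval_chain_map_cup:
  fixes b :: "nat \<Rightarrow> 'a \<Rightarrow> int"
  defines "F \<equiv> \<lambda>k v. cup_coboundaries b k v * b k (v k)"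
  assumes odd: "\<And>i x. i \<le> k \<Longrightarrow> x \<in> topspace X \<Longrightarrow> b i (\<nu> x) = 1 - b i x"
    and c: "singular_chain k X c"
  shows "cochain_eval (\<lambda>f. F k (vertices f)) (chain_map k \<nu> c)
       = (- 1) ^ k * (cochain_eval (\<lambda>f. cup_coboundaries b k (vertices f)) c
                        - cochain_eval (\<lambda>f. F k (vertices f)) c)"
  using c unfolding singular_chain_def
proof (induction c rule: frag_induction)
  case (one f)
  then have f: "singular_simplex k X f" by simp
  have v: "simplicial_vertex i f \<in> topspace X" if "i \<le> k" for i
    using f that by (auto simp: singular_simplex_def simplicial_vertex_def continuous_map_def)
  have "cup_coboundaries b j (vertices (simplex_map k \<nu> f))
      = (- 1) ^ j * cup_coboundaries b j (vertices f)" if "j \<le> k" for j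
    using that
    by (induction j) (auto simp: cup_coboundaries_Suc simplicial_vertex_simplex_map odd v algebra_simps)
  then show ?case
    by (simp add: F_def simplicial_vertex_simplex_map odd v algebra_simps)
next
  case (diff a b)
  then show ?case by (simp add: chain_map_diff cochain_eval_diff algebra_simps)
qed simp

section \<open>Iterated barycentric subdivision of chains\<close>

lemma singular_chain_singular_subdivision_power:
  "singular_chain p X c \<Longrightarrow> singular_chain p X ((singular_subdivision p ^^ n) c)"
  by (induction n) (auto simp: singular_chain_singular_subdivision)

lemma naturality_singular_subdivision_power:
  "singular_chain p X c \<Longrightarrow>
     (singular_subdivision p ^^ n) (chain_map p g c) = chain_map p g ((singular_subdivision p ^^ n) c)"
  by (induction n)
     (auto simp: naturality_singular_subdivision[OF singular_chain_singular_subdivision_power])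

lemma chain_boundary_singular_subdivision_power:
  "singular_chain p X c \<Longrightarrow>
     chain_boundary p ((singular_subdivision p ^^ n) c)
     = (singular_subdivision (p - Suc 0) ^^ n) (chain_boundary p c)"
  by (induction n)
     (auto simp: chain_boundary_singular_subdivision[OF singular_chain_singular_subdivision_power])

lemma singular_subdivision_power_add:
  "(singular_subdivision p ^^ n) (a + b)
   = (singular_subdivision p ^^ n) a + (singular_subdivision p ^^ n) b"
  by (induction n) (auto simp: singular_subdivision_add)

lemma singular_subdivision_power_cmul:
  "(singular_subdivision p ^^ n) (frag_cmul k c) = frag_cmul k ((singular_subdivision p ^^ n) c)"
  by (induction n) (auto simp: singular_subdivision_def frag_extend_cmul)

text \<open>Subdivision fixes chains of degree 0, so the parity argument below still starts from a
  single vertex.\<close>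

lemma singular_subdivision_power_zero:
  "singular_chain 0 X c \<Longrightarrow> (singular_subdivision 0 ^^ n) c = c"
  by (induction n) (auto simp: singular_subdivision_zero)

text \<open>In degree 0 the reduced group is the kernel of the map to the homology of a point. The
  condition for \<open>p = 0\<close>, vanishing augmentation, puts the class of \<open>c\<close>
  into this kernel.\<close>

lemma trivial_reduced_homology_imp_boundary:
  assumes triv: "trivial_group (reduced_homology_group (int p) X)"
    and c: "singular_relcycle p X {} c" and c0: "p = 0 \<Longrightarrow> chain_map p (\<lambda>x. ()) c = 0"
  obtains d where "singular_chain (Suc p) X d" "chain_boundary (Suc p) d = c"
proof -
  let ?Y = "discrete_topology {()}"
  have "homologous_rel_set p X {} c \<in> carrier (reduced_homology_group (int p) X)"
  proof (cases "p = 0")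
    case True
    have "hom_induced (int p) X {} ?Y {} (\<lambda>x. ()) (homologous_rel_set p X {} c)
        = homologous_rel_set p ?Y {} (chain_map p (\<lambda>x. ()) c)"
      by (rule hom_induced_chain_map) (use c in auto)
    also have "\<dots> = singular_relboundary_set p ?Y {}"
      using singular_relboundary_minus[of p ?Y "{}"]
      by (simp add: c0[OF True] homologous_rel_def)
    finally have e: "hom_induced (int p) X {} ?Y {} (\<lambda>x. ()) (homologous_rel_set p X {} c)
        = \<one>\<^bsub>homology_group (int p) ?Y\<^esub>" by (simp only: one_relative_homology_group)
    show ?thesis
      unfolding carrier_reduced_homology_group kernel_def mem_Collect_eq
      using c e by (auto simp: carrier_relative_homology_group)
  next
    case False
    then show ?thesis
      using c by (simp add: un_reduced_homology_group carrier_relative_homology_group)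
  qed
  then have "homologous_rel_set p X {} c = \<one>\<^bsub>reduced_homology_group (int p) X\<^esub>"
    using triv by (auto simp: trivial_group_def)
  then have "homologous_rel_set p X {} c = singular_relboundary_set p X {}"
    by (simp only: one_reduced_homology_group one_relative_homology_group)
  then have "singular_relboundary p X {} c"
    by (metis homologous_rel_refl mem_Collect_eq)
  then show ?thesis
    using that by (auto simp: singular_boundary)
qed

text \<open>The chain \<open>h k\<close> plays the part of the upper hemisphere of the k-sphere.\<close>

lemma equivariant_hemisphere_chains:
  assumes \<nu>: "continuous_map X X \<nu>" "\<And>x. x \<in> topspace X \<Longrightarrow> \<nu> (\<nu> x) = x"
    and f: "singular_simplex 0 X f"
    and triv: "\<And>p. p < m \<Longrightarrow> trivial_group (reduced_homology_group (int p) X)"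
  obtains h where "h 0 = frag_of f" "\<And>k. k \<le> m \<Longrightarrow> singular_chain k X (h k)"
    "\<And>k. k < m \<Longrightarrow> chain_boundary (Suc k) (h (Suc k))
                  = chain_map k \<nu> (h k) + frag_cmul ((- 1) ^ Suc k) (h k)"
proof -
  have "\<exists>h. h 0 = frag_of f \<and> (\<forall>k\<le>m. singular_chain k X (h k)) \<and>
      (\<forall>k<m. chain_boundary (Suc k) (h (Suc k))
            = chain_map k \<nu> (h k) + frag_cmul ((- 1) ^ Suc k) (h k))"
    using triv
  proof (induction m)
    case 0
    then show ?case by (intro exI[of _ "\<lambda>_. frag_of f"]) (simp add: singular_chain_of f)
  next
    case (Suc m)
    then obtain h where h0: "h 0 = frag_of f" and hc: "\<And>k. k \<le> m \<Longrightarrow> singular_chain k X (h k)"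
      and hb: "\<And>k. k < m \<Longrightarrow> chain_boundary (Suc k) (h (Suc k))
            = chain_map k \<nu> (h k) + frag_cmul ((- 1) ^ Suc k) (h k)"
      by (auto simp: less_Suc_eq)
    define c where "c = chain_map m \<nu> (h m) + frag_cmul ((- 1) ^ Suc m) (h m)"
    have "singular_chain m X c"
      unfolding c_def
      by (intro singular_chain_add singular_chain_cmul singular_chain_chain_map[OF _ \<nu>(1)] hc) auto
    \<comment> \<open>As \<nu> is an involution, \<open>h j\<close> and its image under \<nu> each
      occur twice in the boundary, with opposite signs.\<close>
    moreover have "chain_boundary m c = 0"
    proof (cases m)
      case 0
      then show ?thesis by (simp add: chain_boundary_def)
    next
      case (Suc j)
      have "chain_map j \<nu> (chain_map j \<nu> (h j)) = chain_map j (\<nu> \<circ> \<nu>) (h j)"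
        by (simp add: chain_map_compose)
      also have "\<dots> = h j"
        by (rule chain_map_id_gen[where X = X]) (use hc Suc \<nu>(2) in auto)
      finally have e: "chain_map j \<nu> (chain_map j \<nu> (h j)) = h j" .
      have "chain_boundary m (chain_map m \<nu> (h m)) = chain_map j \<nu> (chain_boundary m (h m))"
        using chain_boundary_chain_map[OF hc[of m], of \<nu>] Suc by simp
      then show ?thesis
        using Suc hb[of j]
        by (simp add: c_def chain_boundary_add chain_boundary_cmul chain_boundary_minus chain_boundary_diff chain_map_add chain_map_diff chain_map_minus e
            frag_cmul_distrib2 minus_one_power_iff)
    qed
    moreover have "chain_map m (\<lambda>x. ()) c = 0" if "m = 0"
    proof -
      have "chain_map 0 (\<lambda>x. ()) (chain_map 0 \<nu> (h 0)) = chain_map 0 (\<lambda>x. ()) (h 0)"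
        by (simp add: h0 simplex_map_def fun_eq_iff)
      then show ?thesis using that
        by (simp add: c_def chain_map_add chain_map_minus chain_map_diff)
    qed
    ultimately obtain d where d: "singular_chain (Suc m) X d" "chain_boundary (Suc m) d = c"
      using trivial_reduced_homology_imp_boundary[of m X c] Suc.prems[of m]
      by (auto simp: singular_cycle)
    show ?case
    proof (intro exI[of _ "h(Suc m := d)"] conjI allI impI)
      fix k assume "k < Suc m"
      then show "chain_boundary (Suc k) ((h(Suc m := d)) (Suc k))
          = chain_map k \<nu> ((h(Suc m := d)) k) + frag_cmul ((- 1) ^ Suc k) ((h(Suc m := d)) k)"
        using d hb by (cases "k = m") (auto simp: c_def)
    qed (use h0 hc d in \<open>auto simp: le_Suc_eq\<close>)
  qed
  then show ?thesis using that by blast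
qed

text \<open>If the \<open>f i\<close> had no common zero, then the open sets where some \<open>f i\<close> has a fixed sign would
  cover \<open>X\<close>. The cochains \<open>b i\<close> record these signs, so that the cup product of their coboundaries
  vanishes on simplices which are small with respect to this cover. On the other hand its value on
  \<open>h k\<close> has a parity that does not depend on \<open>k\<close>.\<close>

theorem odd_functions_common_zero:
  fixes f :: "nat \<Rightarrow> 'a \<Rightarrow> real"
  assumes \<nu>: "continuous_map X X \<nu>" "\<And>x. x \<in> topspace X \<Longrightarrow> \<nu> (\<nu> x) = x"
    and ne: "topspace X \<noteq> {}"
    and triv: "\<And>p. p < m \<Longrightarrow> trivial_group (reduced_homology_group (int p) X)"
    and f: "\<And>i. i < m \<Longrightarrow> continuous_map X euclideanreal (f i)"
    and odd: "\<And>i x. i < m \<Longrightarrow> x \<in> topspace X \<Longrightarrow> f i (\<nu> x) = - f i x"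
  obtains x where "x \<in> topspace X" "\<And>i. i < m \<Longrightarrow> f i x = 0"
proof (rule ccontr)
  note found = that
  assume "\<not> thesis"
  with found have nz: "\<exists>i<m. f i x \<noteq> 0" if "x \<in> topspace X" for x
    using that by blast
  \<comment> \<open>The first nonzero \<open>f i x\<close> breaks ties where some \<open>f i\<close>
    vanishes. It is odd, so that \<open>b i\<close> and \<open>b i\<close> after \<nu> add up to 1
    even at zeros of \<open>f i\<close>.\<close>
  define e where "e = (\<lambda>x. f (LEAST i. i < m \<and> f i x \<noteq> 0) x)"
  have e: "e x \<noteq> 0" "e (\<nu> x) = - e x" if x: "x \<in> topspace X" for x
  proof -
    have *: "(LEAST i. i < m \<and> f i x \<noteq> 0) < m \<and> f (LEAST i. i < m \<and> f i x \<noteq> 0) x \<noteq> 0"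
      using LeastI_ex[of "\<lambda>i. i < m \<and> f i x \<noteq> 0"] nz[OF x] by blast
    have "(\<lambda>i. i < m \<and> f i (\<nu> x) \<noteq> 0) = (\<lambda>i. i < m \<and> f i x \<noteq> 0)"
      using odd[OF _ x] by (auto simp: fun_eq_iff)
    then show "e x \<noteq> 0" "e (\<nu> x) = - e x"
      using * odd[OF _ x] by (auto simp: e_def)
  qed
  define b :: "nat \<Rightarrow> 'a \<Rightarrow> int"
    where "b = (\<lambda>i x. if f i x > 0 \<or> f i x = 0 \<and> e x > 0 then 1 else 0)"
  have b_odd: "b i (\<nu> x) = 1 - b i x" if "i < m" "x \<in> topspace X" for i x
    using odd[OF that] e[OF that(2)] by (auto simp: b_def)
  define P N where "P = (\<lambda>i. {x \<in> topspace X. f i x \<in> {0<..}})"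
    and "N = (\<lambda>i. {x \<in> topspace X. f i x \<in> {..<0}})"
  define \<C> where "\<C> = P ` {..<m} \<union> N ` {..<m}"
  have "openin X (P i)" "openin X (N i)" if "i < m" for i
    unfolding P_def N_def
    by (rule openin_continuous_map_preimage[OF f[OF that]], simp)+
  then have "openin X U" if "U \<in> \<C>" for U
    using that by (auto simp: \<C>_def)
  moreover have "topspace X \<subseteq> \<Union>\<C>"
  proof
    fix x assume x: "x \<in> topspace X"
    then obtain i where i: "i < m" "f i x \<noteq> 0" using nz by blast
    then have "x \<in> P i \<or> x \<in> N i" using x by (auto simp: P_def N_def)
    then show "x \<in> \<Union>\<C>" using i(1) by (auto simp: \<C>_def)
  qed
  moreover obtain x0 where x0: "x0 \<in> topspace X" using ne by blast
  define s where "s = restrict (\<lambda>_. x0) (standard_simplex 0)"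
  have s: "singular_simplex 0 X s"
    unfolding singular_simplex_def s_def
  proof
    show "continuous_map (subtopology (powertop_real UNIV) (standard_simplex 0)) X
            (restrict (\<lambda>_. x0) (standard_simplex 0))"
      by (rule continuous_map_eq[of _ _ "\<lambda>_. x0"]) (use x0 in auto)
  qed simp
  obtain h where h: "h 0 = frag_of s" "\<And>k. k \<le> m \<Longrightarrow> singular_chain k X (h k)"
    "\<And>k. k < m \<Longrightarrow> chain_boundary (Suc k) (h (Suc k))
                  = chain_map k \<nu> (h k) + frag_cmul ((- 1) ^ Suc k) (h k)"
    using equivariant_hemisphere_chains[OF \<nu> s triv] by blast
  ultimately obtain n where small: "\<And>\<sigma>. \<sigma> \<in> Poly_Mapping.keys ((singular_subdivision m ^^ n) (h m))
      \<Longrightarrow> \<exists>V\<in>\<C>. \<sigma> \<in> standard_simplex m \<rightarrow> V"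
    using sufficient_iterated_singular_subdivision_exists[of \<C> X m "h m"] h(2)[of m]
    by (metis order_refl)
  \<comment> \<open>All degrees are subdivided \<open>n\<close> times, although \<open>n\<close> is
    chosen for \<open>h m\<close> alone: a common power of subdivision preserves the boundary
    relations.\<close>
  define g where "g = (\<lambda>k. (singular_subdivision k ^^ n) (h k))"
  have g: "g 0 = frag_of s" "\<And>k. k \<le> m \<Longrightarrow> singular_chain k X (g k)"
    using h(1,2) s
    by (auto simp: g_def singular_subdivision_power_zero[of X] singular_chain_of
        intro: singular_chain_singular_subdivision_power)
  have g_bd: "chain_boundary (Suc k) (g (Suc k)) = chain_map k \<nu> (g k) + frag_cmul ((- 1) ^ Suc k) (g k)"
    if "k < m" for k
    using that h(2)[of k] h(2)[of "Suc k"] h(3)[of k]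
    by (simp only: g_def chain_boundary_singular_subdivision_power[of _ X]
        naturality_singular_subdivision_power[of _ X] singular_subdivision_power_add
        singular_subdivision_power_cmul Suc_leI less_imp_le diff_Suc_1 One_nat_def[symmetric])
  let ?W = "\<lambda>k. cochain_eval (\<lambda>\<sigma>. cup_coboundaries b k (vertices \<sigma>)) (g k)"
  \<comment> \<open>The value at 0 is 1. The boundary of \<open>g (Suc k)\<close> is evaluated both
    through the coboundary and through the relation \<open>g_bd\<close>; comparing the results shows
    that consecutive values differ by an even number.\<close>
  have "odd (?W k)" if "k \<le> m" for k
    using that
  proof (induction k)
    case 0
    then show ?case by (simp add: g)
  next
    case (Suc k)
    let ?F = "\<lambda>c. cochain_eval (\<lambda>\<sigma>. cup_coboundaries b k (vertices \<sigma>) * b k (vertices \<sigma> k)) c"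
    have "(- 1) ^ k * ?W (Suc k) = ?F (chain_boundary (Suc k) (g (Suc k)))"
      by (rule cochain_eval_chain_boundary_cup[symmetric])
    also have "\<dots> = ?F (chain_map k \<nu> (g k)) + (- 1) ^ Suc k * ?F (g k)"
      using Suc.prems by (simp only: g_bd Suc_le_eq cochain_eval_add cochain_eval_cmul)
    also have "?F (chain_map k \<nu> (g k)) = (- 1) ^ k * (?W k - ?F (g k))"
      by (rule cochain_eval_chain_map_cup[of k X]) (use Suc.prems b_odd g in auto)
    finally have "(- 1) ^ k * ?W (Suc k) = (- 1) ^ k * (?W k - 2 * ?F (g k))"
      by (simp add: algebra_simps)
    then have "?W (Suc k) = ?W k - 2 * ?F (g k)"
      by simp
    then show ?case using Suc by simp
  qed
  from this[of m] have "?W m \<noteq> 0" by auto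
  then obtain \<sigma> where \<sigma>: "\<sigma> \<in> Poly_Mapping.keys (g m)" "cup_coboundaries b m (vertices \<sigma>) \<noteq> 0"
    by (rule cochain_eval_nonzeroE)
  obtain V where V: "V \<in> \<C>" "\<sigma> \<in> standard_simplex m \<rightarrow> V" using small \<sigma>(1) by (auto simp: g_def)
  then obtain i where i: "i < m" "V = P i \<or> V = N i" by (auto simp: \<C>_def)
  have v: "vertices \<sigma> j \<in> V" if "j \<le> m" for j
    using V(2) that by (auto simp: simplicial_vertex_def)
  \<comment> \<open>On \<open>V\<close> the function \<open>f i\<close> has a fixed nonzero sign, so
    \<open>b i\<close> is constant there and factor \<open>i\<close> of the product
    vanishes.\<close>
  have "b i (vertices \<sigma> (Suc i)) = b i (vertices \<sigma> i)"
    using i v[of i] v[of "Suc i"] by (auto simp: b_def P_def N_def)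
  then show False using \<sigma>(2) i(1) by (auto simp: cup_coboundaries_def)
qed

section \<open>Borsuk-Ulam on coordinate spheres and in Euclidean spaces\<close>

theorem Borsuk_Ulam_nsphere:
  fixes f :: "nat \<Rightarrow> (nat \<Rightarrow> real) \<Rightarrow> real"
  assumes f: "\<And>i. i < n \<Longrightarrow> continuous_map (nsphere n) euclideanreal (f i)"
    and odd: "\<And>i x. i < n \<Longrightarrow> x \<in> topspace (nsphere n) \<Longrightarrow> f i (\<lambda>j. - x j) = - f i x"
  obtains x where "x \<in> topspace (nsphere n)" "\<And>i. i < n \<Longrightarrow> f i x = 0"
proof (rule odd_functions_common_zero[of "nsphere n" "\<lambda>x j. - x j" n f])
  show "continuous_map (nsphere n) (nsphere n) (\<lambda>x j. - x j)"
    using continuous_map_nsphere_projection[of n]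
    by (subst (2) nsphere)
       (auto simp: continuous_map_in_subtopology continuous_map_componentwise_UNIV nsphere)
  show "trivial_group (reduced_homology_group (int p) (nsphere n))" if "p < n" for p
    using that by (simp add: trivial_reduced_homology_group_nsphere)
qed (use f odd that in_topspace_nsphere in auto)

theorem Borsuk_Ulam_sphere:
  fixes f :: "nat \<Rightarrow> 'a::euclidean_space \<Rightarrow> real"
  assumes m: "m < DIM('a)"
    and f: "\<And>i. i < m \<Longrightarrow> continuous_on (sphere 0 1) (f i)"
    and odd: "\<And>i x. i < m \<Longrightarrow> norm x = 1 \<Longrightarrow> f i (- x) = - f i x"
  obtains x where "norm x = 1" "\<And>i. i < m \<Longrightarrow> f i x = 0"
proof -
  define n where "n = DIM('a) - 1"
  have n: "card {..n} = card (Basis :: 'a set)" and "m \<le> n"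
    using m by (auto simp: n_def)
  then obtain \<beta> where \<beta>: "bij_betw \<beta> {..n} (Basis :: 'a set)"
    using finite_same_card_bij[of "{..n}" "Basis :: 'a set"] by auto
  \<comment> \<open>An orthonormal basis identifies the coordinate sphere with the unit sphere by a
    linear isometry, which commutes with the antipodes.\<close>
  define T where "T = (\<lambda>x :: nat \<Rightarrow> real. \<Sum>i\<le>n. x i *\<^sub>R \<beta> i)"
  have norm_T: "(norm (T x))\<^sup>2 = (\<Sum>i\<le>n. (x i)\<^sup>2)" for x
  proof -
    have "(norm (T x))\<^sup>2 = (\<Sum>i\<le>n. \<Sum>j\<le>n. x i * (x j * (\<beta> i \<bullet> \<beta> j)))"
      unfolding T_def power2_norm_eq_inner inner_sum_left
      by (simp add: inner_sum_right sum_distrib_left mult.left_commute)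
    also have "\<dots> = (\<Sum>i\<le>n. \<Sum>j\<le>n. if i = j then x i * x j else 0)"
    proof (intro sum.cong refl)
      fix i j assume "i \<in> {..n}" "j \<in> {..n}"
      then have "\<beta> i \<in> Basis" "\<beta> j \<in> Basis" "\<beta> i = \<beta> j \<longleftrightarrow> i = j"
        using \<beta> by (auto simp: bij_betw_def inj_on_def)
      then show "x i * (x j * (\<beta> i \<bullet> \<beta> j)) = (if i = j then x i * x j else 0)"
        by (simp add: inner_Basis)
    qed
    finally show ?thesis by (simp add: power2_eq_square)
  qed
  have T: "continuous_map (nsphere n) (top_of_set (sphere 0 1)) T"
    unfolding continuous_map_in_subtopology
  proof
    have "continuous_map (nsphere n) euclidean ((\<lambda>r. r *\<^sub>R \<beta> i) \<circ> (\<lambda>x. x i))" for i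
      by (rule continuous_map_compose[OF continuous_map_nsphere_projection])
         (simp add: continuous_intros)
    then show "continuous_map (nsphere n) euclidean T"
      unfolding T_def o_def by (intro continuous_map_sum) auto
    have "norm (T x) = 1" if "x \<in> topspace (nsphere n)" for x
      by (rule power2_eq_imp_eq) (use that norm_T[of x] in \<open>auto simp: nsphere\<close>)
    then show "T \<in> topspace (nsphere n) \<rightarrow> sphere 0 1" by auto
  qed
  have norm1: "norm (T x) = 1" if "x \<in> topspace (nsphere n)" for x
    using T that by (auto simp: continuous_map_def)
  \<comment> \<open>Padding with zero functions, which are odd, raises the number of functions from
    \<open>m\<close> to the dimension \<open>n\<close> of the sphere.\<close>
  obtain x where x: "x \<in> topspace (nsphere n)" "\<And>i. i < n \<Longrightarrow> (if i < m then f i (T x) else 0) = 0"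
  proof (rule Borsuk_Ulam_nsphere[of n "\<lambda>i x. if i < m then f i (T x) else 0"])
    show "continuous_map (nsphere n) euclideanreal (\<lambda>x. if i < m then f i (T x) else 0)" for i
      using continuous_map_compose[OF T, of euclideanreal "f i"] f[of i]
      by (auto simp: o_def)
    have "T (\<lambda>j. - x j) = - T x" for x by (simp add: T_def sum_negf)
    then show "(if i < m then f i (T (\<lambda>j. - x j)) else 0) = - (if i < m then f i (T x) else 0)"
      if "x \<in> topspace (nsphere n)" for i x
      using odd norm1[OF that] by simp
  qed blast
  have "f i (T x) = 0" if "i < m" for i
    using x(2)[of i] that \<open>m \<le> n\<close> by simp
  then show ?thesis
    using that norm1[OF x(1)] by blast
qed

corollary Borsuk_Ulam:
  fixes f :: "'a::euclidean_space \<Rightarrow> 'b::euclidean_space"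
  assumes dim: "DIM('b) < DIM('a)" and f: "continuous_on (sphere 0 1) f"
    and odd: "\<And>x. norm x = 1 \<Longrightarrow> f (- x) = - f x"
  obtains x where "norm x = 1" "f x = 0"
proof -
  obtain \<beta> where \<beta>: "bij_betw \<beta> {..<DIM('b)} (Basis :: 'b set)"
    using finite_same_card_bij[of "{..<DIM('b)}" "Basis :: 'b set"] by auto
  obtain x where x: "norm x = 1" "\<And>i. i < DIM('b) \<Longrightarrow> f x \<bullet> \<beta> i = 0"
    by (rule Borsuk_Ulam_sphere[OF dim, of "\<lambda>i x. f x \<bullet> \<beta> i"])
       (use f odd in \<open>auto intro!: continuous_intros\<close>)
  have "f x \<bullet> b = 0" if "b \<in> Basis" for b
    using x(2) \<beta> that by (force simp: bij_betw_def)
  then have "f x = 0" by (simp add: euclidean_eq_iff[of "f x"])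
  then show ?thesis using that x(1) by blast
qed

section \<open>Quaternionic lines and tensor products\<close>

definition qconj :: "quaternion \<Rightarrow> quaternion" where
  "qconj q = (cnj (fst q), - snd q)"

lemma qmult_assoc: "qmult (qmult p q) r = qmult p (qmult q r)"
  by (simp add: qmult_def algebra_simps)

lemma qmult_add_right: "qmult p (q + r) = qmult p q + qmult p r"
  by (simp add: qmult_def algebra_simps)

lemma qmult_minus_left: "qmult (- p) q = - qmult p q"
  by (simp add: qmult_def)

lemma qmult_minus_right: "qmult p (- q) = - qmult p q"
  by (simp add: qmult_def)

lemma qmult_0_right [simp]: "qmult p 0 = 0"
  by (simp add: qmult_def zero_prod_def)

lemma qmult_0_left [simp]: "qmult 0 q = 0"
  by (simp add: qmult_def zero_prod_def)

lemma qconj_minus: "qconj (- q) = - qconj q"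
  by (simp add: qconj_def)

lemma qmult_qconj: "qmult q (qconj q) = (of_real ((norm q)\<^sup>2), 0)"
  by (cases q) (simp add: qmult_def qconj_def norm_Pair complex_norm_square[symmetric] mult.commute)

lemma qmult_of_real: "qmult q (of_real r, 0) = r *\<^sub>R q"
  by (cases q) (simp add: qmult_def scaleR_conv_of_real mult.commute)

lemma continuous_on_qmult [continuous_intros]:
  "continuous_on S f \<Longrightarrow> continuous_on S g \<Longrightarrow> continuous_on S (\<lambda>x. qmult (f x) (g x))"
  unfolding qmult_def by (intro continuous_intros)

lemma continuous_on_qconj [continuous_intros]:
  "continuous_on S f \<Longrightarrow> continuous_on S (\<lambda>x. qconj (f x))"
  unfolding qconj_def by (intro continuous_intros)

text \<open>The Hermitian form of a left quaternionic space. Left factors come out of the first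
  argument, so pairing q v with v returns q times the real number |v|^2; this reads off the
  coefficient of a section.\<close>

definition qinner :: "quaternion ^ 'n \<Rightarrow> quaternion ^ 'n \<Rightarrow> quaternion" where
  "qinner u v = (\<Sum>k\<in>UNIV. qmult (u $ k) (qconj (v $ k)))"

lemma qinner_minus_right: "qinner u (- v) = - qinner u v"
  by (simp add: qinner_def qconj_minus qmult_minus_right sum_negf)

lemma qmult_sum_right: "qmult p (\<Sum>k\<in>I. f k) = (\<Sum>k\<in>I. qmult p (f k))"
  by (induction I rule: infinite_finite_induct) (simp_all add: qmult_add_right)

lemma qinner_multiple: "qinner (\<chi> k. qmult q (v $ k)) v = (norm v)\<^sup>2 *\<^sub>R q"
proof -
  have "qinner (\<chi> k. qmult q (v $ k)) v = qmult q (\<Sum>k\<in>UNIV. (of_real ((norm (v $ k))\<^sup>2), 0))"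
    by (simp add: qinner_def qmult_assoc qmult_qconj qmult_sum_right)
  also have "(\<Sum>k\<in>UNIV. (of_real ((norm (v $ k))\<^sup>2), 0 :: complex)) = (of_real ((norm v)\<^sup>2), 0)"
    by (simp add: prod_eq_iff fst_sum snd_sum norm_vec_def L2_set_def sum_nonneg)
  finally show ?thesis unfolding qmult_of_real .
qed

lemma quaternionic_line_minus [simp]: "quaternionic_line (- v) = quaternionic_line v"
proof -
  have "quaternionic_line (- v) \<subseteq> quaternionic_line v" for v :: "quaternion ^ 'n"
  proof
    fix u assume "u \<in> quaternionic_line (- v)"
    then obtain q where "u = (\<chi> k. qmult q ((- v) $ k))" by (auto simp: quaternionic_line_def)
    then have "u = (\<chi> k. qmult (- q) (v $ k))"
      by (simp add: vec_eq_iff qmult_minus_left qmult_minus_right)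
    then show "u \<in> quaternionic_line v" by (auto simp: quaternionic_line_def)
  qed
  from this[of v] this[of "- v"] show ?thesis by auto
qed

definition quaternion_coords :: "complex ^ ('n \<times> 2) \<Rightarrow> quaternion ^ 'n" where
  "quaternion_coords a = (\<chi> k. (a $ (k, 1), a $ (k, 2)))"

lemma quaternion_coords_complex_coords [simp]: "quaternion_coords (complex_coords v) = v"
  by (simp add: quaternion_coords_def complex_coords_def vec_eq_iff)

lemma complex_coords_0 [simp]: "complex_coords 0 = 0"
  by (simp add: complex_coords_def vec_eq_iff)

lemma continuous_on_quaternion_coords [continuous_intros]:
  "continuous_on S f \<Longrightarrow> continuous_on S (\<lambda>x. quaternion_coords (f x))"
  unfolding quaternion_coords_def by (intro continuous_intros)

lemma qinner_canonical_bundle_nonzero: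
  assumes "a \<in> canonical_bundle (quaternionic_line v)" "a \<noteq> 0"
  shows "qinner (quaternion_coords a) v \<noteq> 0"
proof -
  obtain q where q: "a = complex_coords (\<chi> k. qmult q (v $ k))"
    using assms(1) by (auto simp: canonical_bundle_def quaternionic_line_def)
  have "(\<chi> k. qmult q (v $ k)) = 0" if "v = 0 \<or> q = 0"
    using that by (auto simp: vec_eq_iff)
  with assms(2) have "v \<noteq> 0" "q \<noteq> 0"
    by (auto simp: q)
  then show ?thesis by (simp add: q qinner_multiple)
qed

text \<open>Complex scaling is left multiplication by a pair (c, 0), so on a left line it acts on
  the coefficient alone.\<close>

lemma subspace_canonical_bundle:
  assumes "L \<in> range quaternionic_line"
  shows "vec.subspace (canonical_bundle L)"
proof -
  obtain v where L: "L = quaternionic_line v" using assms by auto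
  define \<kappa> where "\<kappa> = (\<lambda>q. complex_coords (\<chi> k. qmult q (v $ k)))"
  have 1: "canonical_bundle L = range \<kappa>"
    unfolding canonical_bundle_def L quaternionic_line_def \<kappa>_def by (simp add: image_image)
  have \<kappa>: "\<kappa> 0 = 0" "\<And>p q. \<kappa> (p + q) = \<kappa> p + \<kappa> q"
    "\<And>c q. \<kappa> (c * fst q, c * snd q) = c *s \<kappa> q"
    by (simp_all add: \<kappa>_def zero_vec_def[symmetric])
       (simp_all add: complex_coords_def vec_eq_iff qmult_def algebra_simps)
  show ?thesis
    unfolding vec.subspace_def 1
    by (auto simp: \<kappa>[symmetric] simp del: \<kappa>(1) intro: rangeI[of \<kappa> 0, unfolded \<kappa>(1)])
qed

section \<open>Tensor spaces, the rank one criterion and rotation of factors\<close>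

lemma subspace_tensor_space [simp]: "vec.subspace (tensor_space A B)"
  by (simp add: tensor_space_def)

lemma tensor_in_tensor_space: "a \<in> A \<Longrightarrow> b \<in> B \<Longrightarrow> tensor a b \<in> tensor_space A B"
  unfolding tensor_space_def by (rule vec.span_base) blast

lemma tensor_space_induct:
  assumes "v \<in> tensor_space A B" "vec.subspace {v. P v}"
    "\<And>a b. a \<in> A \<Longrightarrow> b \<in> B \<Longrightarrow> P (tensor a b)"
  shows "P v"
  by (rule vec.span_induct[OF assms(1)[unfolded tensor_space_def] assms(2)]) (use assms(3) in auto)

text \<open>Contracting the second factor with a coordinate functional sends elementary tensors to
  multiples of vectors in \<open>A\<close>, hence the whole span into \<open>A\<close>.\<close>

lemma slice_first:
  assumes "v \<in> tensor_space A B" "vec.subspace A"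
  shows "(\<chi> i. v $ (i, q)) \<in> A"
  using assms(1)
proof (rule tensor_space_induct)
  have e: "(\<chi> i. (u + w) $ (i, q)) = (\<chi> i. u $ (i, q)) + (\<chi> i. w $ (i, q))"
    "(\<chi> i. (c *s u) $ (i, q)) = c *s (\<chi> i. u $ (i, q))"
    "(\<chi> i. (0 :: complex ^ ('i \<times> 'j)) $ (i, q)) = 0"
    for u w :: "complex ^ ('i::finite \<times> 'j::finite)" and c and q
    by (simp_all add: vec_eq_iff)
  show "vec.subspace {v. (\<chi> i. v $ (i, q)) \<in> A}"
    using assms(2) unfolding vec.subspace_def mem_Collect_eq e by blast
  fix a b assume "a \<in> A"
  have "(\<chi> i. tensor a b $ (i, q)) = b $ q *s a"
    by (simp add: vec_eq_iff tensor_def mult.commute)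
  then show "(\<chi> i. tensor a b $ (i, q)) \<in> A"
    using \<open>a \<in> A\<close> assms(2) by (simp add: vec.subspace_scale)
qed

lemma slice_second:
  assumes "v \<in> tensor_space A B" "vec.subspace B"
  shows "(\<chi> q. v $ (i, q)) \<in> B"
  using assms(1)
proof (rule tensor_space_induct)
  have e: "(\<chi> q. (u + w) $ (i, q)) = (\<chi> q. u $ (i, q)) + (\<chi> q. w $ (i, q))"
    "(\<chi> q. (c *s u) $ (i, q)) = c *s (\<chi> q. u $ (i, q))"
    "(\<chi> q. (0 :: complex ^ ('i \<times> 'j)) $ (i, q)) = 0"
    for u w :: "complex ^ ('i::finite \<times> 'j::finite)" and c and i
    by (simp_all add: vec_eq_iff)
  show "vec.subspace {v. (\<chi> q. v $ (i, q)) \<in> B}"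
    using assms(2) unfolding vec.subspace_def mem_Collect_eq e by blast
  fix a b assume "b \<in> B"
  have "(\<chi> q. tensor a b $ (i, q)) = a $ i *s b"
    by (simp add: vec_eq_iff tensor_def)
  then show "(\<chi> q. tensor a b $ (i, q)) \<in> B"
    using \<open>b \<in> B\<close> assms(2) by (simp add: vec.subspace_scale)
qed

text \<open>With rows \<open>i\<close> and columns \<open>q\<close>, splitting means that the matrix
  \<open>v\<close> has rank one. In this form, with all 2 by 2 minors zero, it is visibly a closed
  condition.\<close>

lemma splits_first_iff_minors:
  fixes v :: "complex ^ ('i::finite \<times> 'j::finite \<times> 'k::finite)"
  assumes A: "vec.subspace A" and v: "v \<in> tensor_space A (tensor_space B C)" "v \<noteq> 0"
  shows "splits_first A B C v \<longleftrightarrow>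
    (\<forall>i i' q q'. v $ (i, q) * v $ (i', q') = v $ (i, q') * v $ (i', q))"
proof
  assume "splits_first A B C v"
  then show "\<forall>i i' q q'. v $ (i, q) * v $ (i', q') = v $ (i, q') * v $ (i', q)"
    by (auto simp: splits_first_def tensor_def)
next
  assume minors: "\<forall>i i' q q'. v $ (i, q) * v $ (i', q') = v $ (i, q') * v $ (i', q)"
  obtain i0 q0 where nz: "v $ (i0, q0) \<noteq> 0"
    using v(2) by (auto simp: vec_eq_iff)
  \<comment> \<open>The column and the normalised row through a nonzero entry; being slices of
    \<open>v\<close>, they lie in the required subspaces.\<close>
  define a \<phi> where "a = (\<chi> i. v $ (i, q0))" and "\<phi> = inverse (v $ (i0, q0)) *s (\<chi> q. v $ (i0, q))"
  have "a \<in> A" unfolding a_def by (rule slice_first[OF v(1) A])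
  moreover have "\<phi> \<in> tensor_space B C"
    unfolding \<phi>_def by (intro vec.subspace_scale slice_second[OF v(1)]) simp_all
  moreover have "v = tensor a \<phi>"
    unfolding vec_eq_iff
  proof
    fix p :: "'i \<times> 'j \<times> 'k"
    obtain i q where p: "p = (i, q)" by (cases p)
    have "v $ (i, q) * v $ (i0, q0) = v $ (i, q0) * v $ (i0, q)" using minors by blast
    then show "v $ p = tensor a \<phi> $ p"
      using nz by (simp add: p tensor_def a_def \<phi>_def field_simps)
  qed
  ultimately show "splits_first A B C v" using v(2) by (auto simp: splits_first_def)
qed

lemma rotate_factors_tensor: "rotate_factors (tensor a (tensor b c)) = tensor b (tensor c a)"
  by (simp add: rotate_factors_def tensor_def vec_eq_iff mult.assoc mult.commute)

lemma rotate_factors_linear: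
  "rotate_factors (u + w) = rotate_factors u + rotate_factors w"
  "rotate_factors (c *s u) = c *s rotate_factors u"
  "rotate_factors 0 = 0"
  by (simp_all add: rotate_factors_def vec_eq_iff)

lemma tensor_linear_right:
  "tensor a (u + w) = tensor a u + tensor a w"
  "tensor a (c *s u) = c *s tensor a u"
  "tensor a 0 = 0"
  by (simp_all add: tensor_def vec_eq_iff algebra_simps)

text \<open>Linearity reduces the claim first to a tensor of \<open>a\<close> with some \<phi> and
  then, for fixed \<open>a\<close>, to elementary \<phi>.\<close>

lemma rotate_factors_in_tensor_space:
  assumes "v \<in> tensor_space A (tensor_space B C)"
  shows "rotate_factors v \<in> tensor_space B (tensor_space C A)"
  using assms
proof (rule tensor_space_induct)
  let ?T = "tensor_space B (tensor_space C A)"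
  have T: "vec.subspace ?T" by simp
  show "vec.subspace {v. rotate_factors v \<in> ?T}"
    using T unfolding vec.subspace_def mem_Collect_eq rotate_factors_linear by blast
  fix a \<phi> assume a: "a \<in> A" and "\<phi> \<in> tensor_space B C"
  from this(2) show "rotate_factors (tensor a \<phi>) \<in> ?T"
  proof (rule tensor_space_induct)
    show "vec.subspace {\<phi>. rotate_factors (tensor a \<phi>) \<in> ?T}"
      using T unfolding vec.subspace_def mem_Collect_eq rotate_factors_linear tensor_linear_right by blast
  qed (simp add: rotate_factors_tensor tensor_in_tensor_space a)
qed

lemma rotate_factors_eq_0_iff [simp]: "rotate_factors v = 0 \<longleftrightarrow> v = 0"
  by (auto simp: rotate_factors_def vec_eq_iff)

lemma continuous_section_rotate_factors:
  assumes "continuous_section X (tensor_bundle A (tensor_bundle B C)) \<Gamma>"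
  shows "continuous_section X (tensor_bundle B (tensor_bundle C A)) (rotate_factors \<circ> \<Gamma>)"
proof -
  have "continuous_map euclidean euclidean rotate_factors"
    unfolding rotate_factors_def by (simp add: continuous_intros)
  then show ?thesis
    using assms
    by (auto simp: continuous_section_def tensor_bundle_def rotate_factors_in_tensor_space
        intro: continuous_map_compose)
qed

lemma continuous_map_quaternionic_line:
  "continuous_map (top_of_set (- {0})) HP3 quaternionic_line"
  by (rule quotient_imp_continuous_map[OF quotient_map_HP3])

section \<open>Sections from vanishing Chern classes\<close>

text \<open>The truncation by \<open>\<epsilon>\<close> makes each \<open>\<rho> W\<close> vanish on a neighbourhood of the complement of \<open>D W\<close>, so that
  its product with any function which is continuous on \<open>D W\<close> is continuous.\<close>

lemma invariant_partition_of_unity: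
  fixes K :: "'a::metric_space set"
  assumes K: "compact K" and \<nu>: "continuous_on K \<nu>" "\<And>x. x \<in> K \<Longrightarrow> \<nu> x \<in> K \<and> \<nu> (\<nu> x) = x"
    and op: "\<And>W. W \<in> \<W> \<Longrightarrow> openin (top_of_set K) (D W)"
    and inv: "\<And>W x. W \<in> \<W> \<Longrightarrow> x \<in> K \<Longrightarrow> \<nu> x \<in> D W \<longleftrightarrow> x \<in> D W"
    and cover: "K \<subseteq> (\<Union>W\<in>\<W>. D W)"
  obtains F and \<rho> :: "'b \<Rightarrow> 'a \<Rightarrow> real" and N where
    "finite F" "F \<subseteq> \<W>" "\<And>W. W \<in> F \<Longrightarrow> continuous_on K (\<rho> W)"
    "\<And>W x. x \<in> K \<Longrightarrow> \<rho> W (\<nu> x) = \<rho> W x" "\<And>x. x \<in> K \<Longrightarrow> (\<Sum>W\<in>F. \<rho> W x) = 1"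
    "\<And>W. W \<in> F \<Longrightarrow> openin (top_of_set K) (N W)" "\<And>W. W \<in> F \<Longrightarrow> K \<subseteq> D W \<union> N W"
    "\<And>W x. W \<in> F \<Longrightarrow> x \<in> N W \<Longrightarrow> \<rho> W x = 0"
proof (cases "K = {}")
  case True
  then show ?thesis by (intro that[of "{}" "\<lambda>_ _. 0" D]) auto
next
  case False
  define E where "E = (\<lambda>W. SOME T. open T \<and> D W = K \<inter> T)"
  have E: "open (E W) \<and> D W = K \<inter> E W" if "W \<in> \<W>" for W
    using op[OF that] unfolding E_def openin_open by (rule someI_ex)
  have "K \<subseteq> (\<Union>W\<in>\<W>. E W)" using cover E by blast
  then obtain F where F: "F \<subseteq> \<W>" "finite F" "K \<subseteq> (\<Union>W\<in>F. E W)"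
    using compactE_image[OF K, of \<W> E] E by metis
  then have cover': "\<exists>W\<in>F. x \<in> D W" if "x \<in> K" for x using that E by blast
  \<comment> \<open>As \<open>infdist\<close> to the empty set is 0, the case of an empty complement
    needs its own positive value.\<close>
  define d where "d = (\<lambda>W x. if K \<subseteq> D W then 1 else infdist x (K - D W))"
  have d_cont: "continuous_on K (d W)" for W
    unfolding d_def by (cases "K \<subseteq> D W") (simp_all add: continuous_on_infdist)
  have d_nonneg: "d W x \<ge> 0" for W x by (simp add: d_def infdist_nonneg)
  have d_pos: "d W x > 0 \<longleftrightarrow> x \<in> D W" if "W \<in> F" "x \<in> K" for W x
  proof (cases "K \<subseteq> D W")
    case True
    then show ?thesis using that by (auto simp: d_def)
  next
    case False
    have "K - D W = K - E W" using E F(1) that by blast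
    then have "closed (K - D W)"
      using E[of W] F(1) that compact_imp_closed[OF K] by (auto intro: closed_Diff)
    then have "infdist x (K - D W) = 0 \<longleftrightarrow> x \<in> K - D W"
      using False by (intro in_closed_iff_infdist_zero[symmetric]) auto
    then show ?thesis using False that d_nonneg[of W x] by (auto simp: d_def less_le)
  qed
  \<comment> \<open>Symmetrised over the involution. Since \<open>D W\<close> is invariant, it
    remains the set where the function is positive.\<close>
  define g where "g = (\<lambda>W x. d W x + d W (\<nu> x))"
  have g_cont: "continuous_on K (g W)" for W
    unfolding g_def using \<nu>
    by (intro continuous_on_add d_cont continuous_on_compose2[OF d_cont \<nu>(1)]) auto
  have g_inv: "g W (\<nu> x) = g W x" if "x \<in> K" for W x
    using \<nu>(2)[OF that] by (simp add: g_def)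
  have g_nonneg: "g W x \<ge> 0" for W x by (simp add: g_def d_nonneg)
  have g_pos: "g W x > 0 \<longleftrightarrow> x \<in> D W" if "W \<in> F" "x \<in> K" for W x
  proof -
    have "W \<in> \<W>" using F(1) that by blast
    then have "d W (\<nu> x) > 0 \<longleftrightarrow> x \<in> D W"
      using d_pos[OF that(1), of "\<nu> x"] \<nu>(2)[OF that(2)] inv[of W x] that by auto
    then show ?thesis
      using d_pos[OF that] d_nonneg[of W x] d_nonneg[of W "\<nu> x"] by (auto simp: g_def)
  qed
  define G where "G = (\<lambda>x. \<Sum>W\<in>F. g W x)"
  have "continuous_on K G" unfolding G_def by (intro continuous_on_sum g_cont)
  then obtain x0 where x0: "x0 \<in> K" "\<And>x. x \<in> K \<Longrightarrow> G x0 \<le> G x"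
    using continuous_attains_inf[OF K False] by blast
  have "G x0 > 0"
    unfolding G_def using F(2) g_nonneg cover'[OF x0(1)] g_pos[OF _ x0(1)]
    by (auto intro: sum_pos2)
  \<comment> \<open>Half the minimum of \<open>G\<close>, shared equally among the members of
    \<open>F\<close>: if every \<open>g W x\<close> were at most \<epsilon>, then \<open>G x\<close>
    would be at most half its minimum.\<close>
  define \<epsilon> where "\<epsilon> = G x0 / (2 * real (card F))"
  have card: "card F > 0" using cover'[OF x0(1)] F(2) by (auto simp: card_gt_0_iff)
  have \<epsilon>: "\<epsilon> > 0" using \<open>G x0 > 0\<close> card by (simp add: \<epsilon>_def)
  have big: "\<exists>W\<in>F. g W x > \<epsilon>" if "x \<in> K" for x
  proof (rule ccontr)
    assume "\<not> ?thesis"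
    then have "G x \<le> (\<Sum>W\<in>F. \<epsilon>)" unfolding G_def by (intro sum_mono) auto
    also have "\<dots> = G x0 / 2" using card by (simp add: \<epsilon>_def)
    finally show False using x0(2)[OF that] \<open>G x0 > 0\<close> by simp
  qed
  define t where "t = (\<lambda>W x. max 0 (g W x - \<epsilon>))"
  have t_cont: "continuous_on K (t W)" for W
    unfolding t_def by (intro continuous_intros g_cont)
  have t_pos: "(\<Sum>W\<in>F. t W x) > 0" if "x \<in> K" for x
    using big[OF that] F(2) by (auto simp: t_def intro: sum_pos2)
  define \<rho> where "\<rho> = (\<lambda>W x. t W x / (\<Sum>V\<in>F. t V x))"
  define N where "N = (\<lambda>W. {x \<in> K. g W x \<in> {..<\<epsilon>}})"
  show ?thesis
  proof (rule that[of F \<rho> N])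
    show "continuous_on K (\<rho> W)" for W
      unfolding \<rho>_def using t_pos
      by (intro continuous_on_divide continuous_on_sum t_cont) (metis less_irrefl)
    show "\<rho> W (\<nu> x) = \<rho> W x" if "x \<in> K" for W x
      by (simp add: \<rho>_def t_def g_inv[OF that])
    show "(\<Sum>W\<in>F. \<rho> W x) = 1" if "x \<in> K" for x
      using t_pos[OF that] by (simp add: \<rho>_def sum_divide_distrib[symmetric])
    show "openin (top_of_set K) (N W)" for W
      using continuous_openin_preimage_gen[OF g_cont[of W], of "{..<\<epsilon>}"]
      by (simp add: N_def vimage_def Int_def)
    show "K \<subseteq> D W \<union> N W" if "W \<in> F" for W
    proof
      fix x assume x: "x \<in> K"
      then show "x \<in> D W \<union> N W"
        using g_pos[OF that x] \<epsilon> by (cases "x \<in> D W") (auto simp: N_def not_less)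
    qed
    show "\<rho> W x = 0" if "x \<in> N W" for W x
      using that by (simp add: N_def \<rho>_def t_def)
  qed (use F in auto)
qed

text \<open>A Chern cocycle which is a coboundary makes the phases \<open>\<phi>\<close>, corrected by integers, a real cocycle
  \<open>\<psi>\<close>. The partition of unity turns it into a coboundary of real functions \<open>\<theta>\<close>, and these rotate the
  local sections into a global one.\<close>

lemma chern_class_zero_imp_invariant_section:
  fixes K :: "'a::metric_space set" and L :: "('x, 'n::finite) subbundle"
  assumes zero: "first_chern_class Y L = cech_H2_zero Y"
    and phase: "\<And>y c l. y \<in> topspace Y \<Longrightarrow> l \<in> L y \<Longrightarrow> norm c = 1 \<Longrightarrow> c *s l \<in> L y"
    and K: "compact K" and \<pi>: "continuous_map (top_of_set K) Y \<pi>"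
    and \<nu>: "continuous_on K \<nu>" "\<And>x. x \<in> K \<Longrightarrow> \<nu> x \<in> K \<and> \<nu> (\<nu> x) = x"
    and \<pi>\<nu>: "\<And>x. x \<in> K \<Longrightarrow> \<pi> (\<nu> x) = \<pi> x"
  obtains a where "continuous_on K a" "\<And>x. x \<in> K \<Longrightarrow> a x \<in> L (\<pi> x)"
    "\<And>x. x \<in> K \<Longrightarrow> a x \<noteq> 0" "\<And>x. x \<in> K \<Longrightarrow> a (\<nu> x) = a x"
proof -
  have "({topspace Y}, \<lambda>U V W x. 0) \<in> cech_Z2 Y"
    by (simp add: cech_Z2_def open_cover_def locally_const_on_def)
  \<comment> \<open>The zero cocycle lies in the class on the right, hence in the one on the left.
    This yields at once a Chern cocycle, with its local sections, and a cochain exhibiting it as a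
    coboundary.\<close>
  then have "({topspace Y}, \<lambda>U V W x. 0) \<in> first_chern_class Y L"
    unfolding zero cech_H2_zero_def by (rule equiv_class_self[OF equiv_cech_rel])
  then obtain \<U> n where chern: "is_chern_cocycle Y L \<U> n"
    and rel: "((\<U>, n), ({topspace Y}, \<lambda>U V W x. 0)) \<in> cech_rel Y"
    unfolding first_chern_class_def by blast
  obtain s \<phi> where
    *: "\<forall>U\<in>\<U>. continuous_section (subtopology Y U) L (s U) \<and> (\<forall>x\<in>U. norm (s U x) = 1)"
       "\<forall>U\<in>\<U>. \<forall>V\<in>\<U>. continuous_map (subtopology Y (U \<inter> V)) euclideanreal (\<phi> U V) \<and>
          (\<forall>x\<in>U \<inter> V. s V x = cis (2 * pi * \<phi> U V x) *s s U x)"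
       "\<forall>U\<in>\<U>. \<forall>V\<in>\<U>. \<forall>W\<in>\<U>. \<forall>x\<in>U \<inter> V \<inter> W.
          real_of_int (n U V W x) = \<phi> V W x - \<phi> U W x + \<phi> U V x"
    using chern unfolding is_chern_cocycle_def by (elim conjE exE) (rule that; assumption)
  have s: "continuous_section (subtopology Y U) L (s U)" "x \<in> U \<Longrightarrow> norm (s U x) = 1"
    if "U \<in> \<U>" for U x
    using *(1) that by blast+
  have \<phi>: "continuous_map (subtopology Y (U \<inter> V)) euclideanreal (\<phi> U V)"
    "x \<in> U \<inter> V \<Longrightarrow> s V x = cis (2 * pi * \<phi> U V x) *s s U x"
    if "U \<in> \<U>" "V \<in> \<U>" for U V x
    using *(2) that by blast+
  note n = *(3)[rule_format]
  obtain \<W> r m where \<W>: "open_cover Y \<W>" and r: "refinement_map \<W> \<U> r" and m: "is_cochain1 Y \<W> m"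
    and **: "\<forall>U\<in>\<W>. \<forall>V\<in>\<W>. \<forall>W\<in>\<W>. \<forall>x\<in>U \<inter> V \<inter> W.
      n (r U) (r V) (r W) x - 0 = coboundary1 m U V W x"
    using rel unfolding cech_rel_def mem_Collect_eq case_prod_conv
    by (elim conjE exE) (rule that; assumption)
  have nm: "n (r U) (r V) (r W) x = coboundary1 m U V W x"
    if "U \<in> \<W>" "V \<in> \<W>" "W \<in> \<W>" "x \<in> U \<inter> V \<inter> W" for U V W x
    using **[rule_format, OF that] by simp
  have rU: "r U \<in> \<U>" "x \<in> U \<Longrightarrow> x \<in> r U" if "U \<in> \<W>" for U x
    using r that by (auto simp: refinement_map_def)
  \<comment> \<open>Subtracting the integers \<open>m\<close> leaves the transition functions
    \<open>cis (2 * pi * \<psi>)\<close> unchanged, while \<open>n\<close> being the coboundary of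
    \<open>m\<close> makes the sum in the cocycle condition zero.\<close>
  define \<psi> where "\<psi> = (\<lambda>U V x. \<phi> (r U) (r V) x - real_of_int (m U V x))"
  have \<psi>_cocycle: "\<psi> V W x - \<psi> U W x + \<psi> U V x = 0"
    if "U \<in> \<W>" "V \<in> \<W>" "W \<in> \<W>" "x \<in> U \<inter> V \<inter> W" for U V W x
  proof -
    have "real_of_int (n (r U) (r V) (r W) x) = \<phi> (r V) (r W) x - \<phi> (r U) (r W) x + \<phi> (r U) (r V) x"
      by (rule n) (use that rU in auto)
    then show ?thesis using nm[OF that] by (simp add: \<psi>_def coboundary1_def)
  qed
  have s_\<psi>: "s (r V) x = cis (2 * pi * \<psi> U V x) *s s (r U) x"
    if "U \<in> \<W>" "V \<in> \<W>" "x \<in> U \<inter> V" for U V x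
  proof -
    have "cis (2 * pi * \<psi> U V x) = cis (2 * pi * \<phi> (r U) (r V) x)"
      by (simp add: \<psi>_def right_diff_distrib cis_divide[symmetric] cis_multiple_2pi)
    then show ?thesis using \<phi>(2)[of "r U" "r V" x] that rU by auto
  qed
  have \<psi>_cont: "continuous_map (subtopology Y (U \<inter> V)) euclideanreal (\<psi> U V)"
    if "U \<in> \<W>" "V \<in> \<W>" for U V
  proof -
    have "continuous_map (subtopology Y (U \<inter> V)) euclideanreal (real_of_int \<circ> m U V)"
      using m that unfolding is_cochain1_def locally_const_on_def
      by (intro continuous_map_compose[of _ "discrete_topology UNIV"]) auto
    moreover have "continuous_map (subtopology Y (U \<inter> V)) euclideanreal (\<phi> (r U) (r V))"
      by (rule continuous_map_from_subtopology_mono[OF \<phi>(1)]) (use that rU in auto)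
    ultimately show ?thesis
      unfolding \<psi>_def by (intro continuous_map_diff) (auto simp: o_def)
  qed
  define D where "D = (\<lambda>W. {x \<in> K. \<pi> x \<in> W})"
  have D: "openin (top_of_set K) (D W)" if "W \<in> \<W>" for W
    using openin_continuous_map_preimage[OF \<pi>, of W] \<W> that by (auto simp: D_def open_cover_def)
  have \<pi>D: "continuous_map (top_of_set (D U)) (subtopology Y U) \<pi>" for U
    using \<pi> by (auto simp: continuous_map_in_subtopology D_def
        intro: continuous_map_from_subtopology_mono)
  have \<pi>Y: "\<pi> x \<in> topspace Y" if "x \<in> K" for x
    using \<pi> that by (auto simp: continuous_map_def)
  have D_inv: "\<nu> x \<in> D W \<longleftrightarrow> x \<in> D W" if "x \<in> K" for W x
    using \<nu>(2)[OF that] \<pi>\<nu>[OF that] that by (auto simp: D_def)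
  have D_cover: "K \<subseteq> (\<Union>W\<in>\<W>. D W)"
    using \<W> \<pi>Y by (auto simp: D_def open_cover_def)
  obtain F \<rho> N where F: "finite F" "F \<subseteq> \<W>"
    and \<rho>: "\<And>W. W \<in> F \<Longrightarrow> continuous_on K (\<rho> W)" "\<And>W x. x \<in> K \<Longrightarrow> \<rho> W (\<nu> x) = \<rho> W x"
      "\<And>x. x \<in> K \<Longrightarrow> (\<Sum>W\<in>F. \<rho> W x) = (1::real)"
    and N: "\<And>W. W \<in> F \<Longrightarrow> openin (top_of_set K) (N W)" "\<And>W. W \<in> F \<Longrightarrow> K \<subseteq> D W \<union> N W"
      "\<And>W x. W \<in> F \<Longrightarrow> x \<in> N W \<Longrightarrow> \<rho> W x = 0"
  proof -
    show thesis
      by (rule invariant_partition_of_unity[OF K \<nu> D D_inv D_cover]) (assumption | fact that)+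
  qed
  \<comment> \<open>The default 0 outside \<open>D V\<close> is harmless because \<rho> vanishes
    there. The cocycle identity and the total weight 1 give \<theta> \<open>U\<close> - \<theta>
    \<open>V\<close> = \<psi> \<open>U V\<close>.\<close>
  define \<theta> where "\<theta> = (\<lambda>U x. \<Sum>V\<in>F. \<rho> V x * (if x \<in> D V then \<psi> U V (\<pi> x) else 0))"
  have "continuous_on (D U) (\<lambda>x. \<rho> V x * (if x \<in> D V then \<psi> U V (\<pi> x) else 0))"
    if U: "U \<in> \<W>" and V: "V \<in> F" for U V
  proof -
    \<comment> \<open>Continuity is checked on two open pieces: \<open>D V\<close>, where \<psi> is
      defined, and \<open>N V\<close>, where the summand is 0.\<close>
    define T where "T = (\<lambda>b. if b then D V else N V)"
    define f where "f = (\<lambda>b x. if b then \<rho> V x * \<psi> U V (\<pi> x) else 0)"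
    have V': "V \<in> \<W>" using V F by blast
    have "continuous_map (top_of_set (D U)) euclideanreal
        (\<lambda>x. \<rho> V x * (if x \<in> D V then \<psi> U V (\<pi> x) else 0))"
    proof (rule pasting_lemma[where I = UNIV and T = "\<lambda>b. D U \<inter> T b" and f = f])
      fix b :: bool
      have "openin (top_of_set K) (T b)" using D[OF V'] N(1)[OF V] by (simp add: T_def)
      then show "openin (top_of_set (D U)) (D U \<inter> T b)"
        by (metis D U inf_commute openin_Int openin_imp_subset openin_subset_trans inf_le2)
      have "continuous_on (D U \<inter> D V) (\<lambda>x. \<psi> U V (\<pi> x))"
      proof -
        have "continuous_map (top_of_set (D (U \<inter> V))) euclideanreal (\<psi> U V \<circ> \<pi>)"
          by (rule continuous_map_compose[OF \<pi>D \<psi>_cont[OF U V']])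
        moreover have "D (U \<inter> V) = D U \<inter> D V" by (auto simp: D_def)
        ultimately show ?thesis by (simp add: o_def)
      qed
      moreover have "continuous_on (D U \<inter> D V) (\<rho> V)"
        by (rule continuous_on_subset[OF \<rho>(1)[OF V]]) (auto simp: D_def)
      ultimately show "continuous_map (subtopology (top_of_set (D U)) (D U \<inter> T b)) euclideanreal (f b)"
        by (auto simp: subtopology_subtopology f_def T_def intro: continuous_on_mult)
    next
      fix b b' :: bool and x
      assume "x \<in> topspace (top_of_set (D U)) \<inter> (D U \<inter> T b) \<inter> (D U \<inter> T b')"
      then show "f b x = f b' x" using N(3)[OF V] by (auto simp: f_def T_def split: if_splits)
    next
      fix x assume x: "x \<in> topspace (top_of_set (D U))"
      then have "x \<in> D V \<or> x \<in> N V" using N(2)[OF V] by (auto simp: D_def)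
      then show "\<exists>b. b \<in> UNIV \<and> x \<in> D U \<inter> T b \<and>
          \<rho> V x * (if x \<in> D V then \<psi> U V (\<pi> x) else 0) = f b x"
        using x N(3)[OF V, of x]
        by (intro exI[of _ "x \<in> D V"]) (auto simp: T_def f_def)
    qed
    then show ?thesis by simp
  qed
  then have \<theta>_cont: "continuous_on (D U) (\<theta> U)" if "U \<in> \<W>" for U
    unfolding \<theta>_def using that by (intro continuous_on_sum) auto
  have \<theta>_diff: "\<theta> U x - \<theta> V x = \<psi> U V (\<pi> x)"
    if "U \<in> \<W>" "V \<in> \<W>" "x \<in> D U" "x \<in> D V" for U V x
  proof -
    have x: "x \<in> K" using that by (simp add: D_def)
    have "\<theta> U x - \<theta> V x = (\<Sum>W\<in>F. \<rho> W x * \<psi> U V (\<pi> x))"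
      unfolding \<theta>_def sum_subtractf[symmetric]
    proof (rule sum.cong[OF refl])
      fix W assume W: "W \<in> F"
      show "\<rho> W x * (if x \<in> D W then \<psi> U W (\<pi> x) else 0)
          - \<rho> W x * (if x \<in> D W then \<psi> V W (\<pi> x) else 0) = \<rho> W x * \<psi> U V (\<pi> x)"
      proof (cases "x \<in> D W")
        case True
        then have "\<psi> V W (\<pi> x) - \<psi> U W (\<pi> x) + \<psi> U V (\<pi> x) = 0"
          using that W F by (intro \<psi>_cocycle) (auto simp: D_def)
        then have "\<psi> U V (\<pi> x) = \<psi> U W (\<pi> x) - \<psi> V W (\<pi> x)" by simp
        then show ?thesis using True by (simp add: right_diff_distrib)
      next
        case False
        then have "x \<in> N W" using N(2)[OF W] x by blast
        then show ?thesis using N(3)[OF W] by simp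
      qed
    qed
    then show ?thesis using \<rho>(3)[OF x] by (simp add: sum_distrib_right[symmetric])
  qed
  \<comment> \<open>On overlaps \<theta> \<open>V\<close> + \<psi> \<open>U V\<close> = \<theta>
    \<open>U\<close>, so these rotated local sections agree.\<close>
  define A where "A = (\<lambda>U x. cis (2 * pi * \<theta> U x) *s s (r U) (\<pi> x))"
  have A_eq: "A U x = A V x" if "U \<in> \<W>" "V \<in> \<W>" "x \<in> D U" "x \<in> D V" for U V x
  proof -
    have "A V x = (cis (2 * pi * \<theta> V x) * cis (2 * pi * \<psi> U V (\<pi> x))) *s s (r U) (\<pi> x)"
      using s_\<psi>[of U V "\<pi> x"] that by (simp add: A_def D_def)
    also have "cis (2 * pi * \<theta> V x) * cis (2 * pi * \<psi> U V (\<pi> x)) = cis (2 * pi * \<theta> U x)"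
      unfolding \<theta>_diff[OF that, symmetric] by (simp add: cis_mult right_diff_distrib)
    finally show ?thesis by (simp add: A_def)
  qed
  \<comment> \<open>The member of the cover is chosen from the base point, so that the choice is the
    same at \<open>x\<close> and \<nu> \<open>x\<close>.\<close>
  define \<sigma> where "\<sigma> = (\<lambda>y. SOME U. U \<in> \<W> \<and> y \<in> U)"
  have \<sigma>: "\<sigma> (\<pi> x) \<in> \<W>" "x \<in> D (\<sigma> (\<pi> x))" if "x \<in> K" for x
  proof -
    have "\<exists>U. U \<in> \<W> \<and> \<pi> x \<in> U" using \<W> \<pi>Y[OF that] by (auto simp: open_cover_def)
    then have "\<sigma> (\<pi> x) \<in> \<W> \<and> \<pi> x \<in> \<sigma> (\<pi> x)" unfolding \<sigma>_def by (rule someI_ex)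
    then show "\<sigma> (\<pi> x) \<in> \<W>" "x \<in> D (\<sigma> (\<pi> x))" using that by (auto simp: D_def)
  qed
  have s_norm: "norm (s (r U) (\<pi> x)) = 1" if "U \<in> \<W>" "x \<in> D U" for U x
    using s(2)[of "r U" "\<pi> x"] rU that by (auto simp: D_def)
  show ?thesis
  proof (rule that[of "\<lambda>x. A (\<sigma> (\<pi> x)) x"])
    have "continuous_map (top_of_set K) euclidean (\<lambda>x. A (\<sigma> (\<pi> x)) x)"
    proof (rule pasting_lemma[where I = \<W> and T = D and f = A])
      fix U assume U: "U \<in> \<W>"
      show "openin (top_of_set K) (D U)" by (rule D[OF U])
      have "continuous_map (top_of_set (D U)) (subtopology Y (r U)) \<pi>"
        using \<pi>D[of U] rU[OF U] by (auto simp: continuous_map_in_subtopology)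
      then have "continuous_map (top_of_set (D U)) euclidean (s (r U) \<circ> \<pi>)"
        using s(1)[of "r U"] rU[OF U] unfolding continuous_section_def
        by (intro continuous_map_compose) auto
      then have 1: "continuous_on (D U) (\<lambda>x. s (r U) (\<pi> x))" by (simp add: o_def)
      have "continuous_on (D U) (A U)"
        unfolding A_def vector_scalar_mult_def
        by (intro continuous_on_vec_lambda continuous_on_mult continuous_on_cis continuous_on_const
            continuous_on_component \<theta>_cont U 1)
      moreover have "K \<inter> D U = D U" by (auto simp: D_def)
      ultimately show "continuous_map (subtopology (top_of_set K) (D U)) euclidean (A U)"
        by (simp add: subtopology_subtopology)
    next
      fix x assume "x \<in> topspace (top_of_set K)"
      then show "\<exists>U. U \<in> \<W> \<and> x \<in> D U \<and> A (\<sigma> (\<pi> x)) x = A U x" using \<sigma> by auto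
    qed (auto intro: A_eq)
    then show "continuous_on K (\<lambda>x. A (\<sigma> (\<pi> x)) x)" by simp
    fix x assume x: "x \<in> K"
    let ?U = "\<sigma> (\<pi> x)"
    have "s (r ?U) (\<pi> x) \<in> L (\<pi> x)"
      using s(1)[OF rU(1)[OF \<sigma>(1)[OF x]]] \<sigma>[OF x] rU \<pi>Y[OF x]
      by (auto simp: continuous_section_def D_def)
    then show "A ?U x \<in> L (\<pi> x)"
      unfolding A_def by (intro phase \<pi>Y x) simp_all
    have "s (r ?U) (\<pi> x) \<noteq> 0" using s_norm[OF \<sigma>[OF x]] by auto
    then show "A ?U x \<noteq> 0" by (simp add: A_def)
    have "\<theta> U (\<nu> x) = \<theta> U x" for U
      by (simp add: \<theta>_def \<rho>(2)[OF x] D_inv[OF x] \<pi>\<nu>[OF x] cong: if_cong)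
    then show "A (\<sigma> (\<pi> (\<nu> x))) (\<nu> x) = A ?U x"
      by (simp add: A_def \<pi>\<nu>[OF x])
  qed
qed

section \<open>The splitting loci\<close>

text \<open>A phase on the first factor is compensated by its inverse on the second.\<close>

lemma phase_first_factor:
  assumes A: "vec.subspace (A x)" and a: "a \<in> first_factor A B C \<Gamma> x" and c: "norm c = 1"
  shows "c *s a \<in> first_factor A B C \<Gamma> x"
proof (cases "a = 0")
  case True
  then show ?thesis by (simp add: first_factor_def)
next
  case False
  then obtain \<phi> where "a \<in> A x" "\<phi> \<in> tensor_bundle B C x" "\<Gamma> x = tensor a \<phi>"
    using a by (auto simp: first_factor_def)
  moreover have "c \<noteq> 0" using c by auto
  then have "tensor a \<phi> = tensor (c *s a) (inverse c *s \<phi>)"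
    by (simp add: tensor_def vec_eq_iff)
  ultimately have "c *s a \<in> A x" "inverse c *s \<phi> \<in> tensor_bundle B C x"
    "\<Gamma> x = tensor (c *s a) (inverse c *s \<phi>)"
    using A by (simp_all add: vec.subspace_scale tensor_bundle_def)
  then show ?thesis unfolding first_factor_def by blast
qed

lemma quaternionic_line_in_topspace: "v \<noteq> 0 \<Longrightarrow> quaternionic_line v \<in> topspace HP3"
  unfolding topspace_HP3 by (rule imageI) simp

lemma compact_splitting_locus:
  fixes A :: "((quaternion ^ 4) set, 'i::finite) subbundle"
  assumes A: "\<And>x. x \<in> topspace HP3 \<Longrightarrow> vec.subspace (A x)"
    and \<Gamma>: "continuous_section HP3 (tensor_bundle A (tensor_bundle B C)) \<Gamma>"
    and nz: "\<And>x. x \<in> topspace HP3 \<Longrightarrow> \<Gamma> x \<noteq> 0"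
  shows "compact {v. norm v = 1 \<and> quaternionic_line v \<in> splitting_locus HP3 A B C \<Gamma>}"
proof -
  let ?G = "\<lambda>v. \<Gamma> (quaternionic_line v)"
  have "continuous_on (- {0}) ?G"
    using continuous_map_compose[OF continuous_map_quaternionic_line, of euclidean \<Gamma>] \<Gamma>
    by (simp add: continuous_section_def o_def)
  then have G: "continuous_on (sphere 0 1) ?G"
    by (rule continuous_on_subset) auto
  have top: "quaternionic_line v \<in> topspace HP3" if "norm v = 1" for v
    using that by (intro quaternionic_line_in_topspace) auto
  have "{v. norm v = 1 \<and> quaternionic_line v \<in> splitting_locus HP3 A B C \<Gamma>}
      = (\<Inter>i. \<Inter>i'. \<Inter>q. \<Inter>q'. {v \<in> sphere 0 1. ?G v $ (i, q) * ?G v $ (i', q') = ?G v $ (i, q') * ?G v $ (i', q)})"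
    (is "?K = _")
  proof -
    have "quaternionic_line v \<in> splitting_locus HP3 A B C \<Gamma> \<longleftrightarrow>
        (\<forall>i i' q q'. ?G v $ (i, q) * ?G v $ (i', q') = ?G v $ (i, q') * ?G v $ (i', q))"
      if "norm v = 1" for v
    proof -
      note x = top[OF that]
      have "?G v \<in> tensor_space (A (quaternionic_line v))
          (tensor_space (B (quaternionic_line v)) (C (quaternionic_line v)))"
        using \<Gamma> x by (simp add: continuous_section_def tensor_bundle_def)
      from splits_first_iff_minors[OF A[OF x] this nz[OF x]]
      show ?thesis using x by (simp only: splitting_locus_def mem_Collect_eq simp_thms)
    qed
    then have "?K = {v \<in> sphere 0 1. \<forall>i i' q q'.
        ?G v $ (i, q) * ?G v $ (i', q') = ?G v $ (i, q') * ?G v $ (i', q)}"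
      by (intro Collect_cong) (metis mem_sphere_0)
    also have "\<dots> = (\<Inter>i. \<Inter>i'. \<Inter>q. \<Inter>q'. {v \<in> sphere 0 1.
        ?G v $ (i, q) * ?G v $ (i', q') = ?G v $ (i, q') * ?G v $ (i', q)})"
      by blast
    finally show ?thesis .
  qed
  also have "closed \<dots>"
  proof (intro closed_INT ballI)
    fix i i' q q'
    have "closedin (top_of_set (sphere 0 1)) {v \<in> sphere 0 1.
        ?G v $ (i, q) * ?G v $ (i', q') - ?G v $ (i, q') * ?G v $ (i', q) = 0}"
      by (intro continuous_closedin_preimage_constant continuous_intros G)
    then show "closed {v \<in> sphere 0 1. ?G v $ (i, q) * ?G v $ (i', q') = ?G v $ (i, q') * ?G v $ (i', q)}"
      by (simp add: closedin_closed_eq)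
  qed
  finally have "closed ?K" .
  then have "compact (sphere 0 1 \<inter> ?K)" by (intro compact_Int_closed) auto
  moreover have "sphere 0 1 \<inter> ?K = ?K" by auto
  ultimately show ?thesis by simp
qed

text \<open>The lift takes the same value at \<open>v\<close> and \<open>- v\<close>, while the
  vector it is paired with changes sign; hence its coefficient \<open>g\<close> is odd on the
  preimage of the locus.\<close>

lemma untwisted_first_imp_odd_map:
  assumes \<Gamma>: "continuous_section HP3 (tensor_bundle canonical_bundle (tensor_bundle B C)) \<Gamma>"
    and nz: "\<And>x. x \<in> topspace HP3 \<Longrightarrow> \<Gamma> x \<noteq> 0"
    and untw: "untwisted_first HP3 canonical_bundle B C \<Gamma>"
  obtains f :: "quaternion ^ 4 \<Rightarrow> quaternion" where
    "continuous_on (sphere 0 1) f" "\<And>v. norm v = 1 \<Longrightarrow> f (- v) = - f v"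
    "\<And>v. norm v = 1 \<Longrightarrow> quaternionic_line v \<in> splitting_locus HP3 canonical_bundle B C \<Gamma> \<Longrightarrow> f v \<noteq> 0"
proof -
  let ?Z = "splitting_locus HP3 canonical_bundle B C \<Gamma>"
  let ?L = "first_factor canonical_bundle B C \<Gamma>"
  define K where "K = {v. norm v = 1 \<and> quaternionic_line v \<in> ?Z}"
  have sub: "vec.subspace (canonical_bundle x)" if "x \<in> topspace HP3" for x
    using that unfolding topspace_HP3 by (intro subspace_canonical_bundle) auto
  have K: "compact K"
    unfolding K_def using sub \<Gamma> nz by (rule compact_splitting_locus)
  have K_minus: "- v \<in> K" if "v \<in> K" for v using that by (simp add: K_def)
  obtain a where a: "continuous_on K a" "\<And>v. v \<in> K \<Longrightarrow> a v \<in> ?L (quaternionic_line v)"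
    "\<And>v. v \<in> K \<Longrightarrow> a v \<noteq> 0" "\<And>v. v \<in> K \<Longrightarrow> a (- v) = a v"
  proof (rule chern_class_zero_imp_invariant_section[of "subtopology HP3 ?Z" ?L K quaternionic_line uminus])
    show "first_chern_class (subtopology HP3 ?Z) ?L = cech_H2_zero (subtopology HP3 ?Z)"
      using untw by (simp add: untwisted_first_def Let_def)
    show "c *s l \<in> ?L y" if "y \<in> topspace (subtopology HP3 ?Z)" "l \<in> ?L y" "norm c = 1" for y c l
      using that by (intro phase_first_factor[of canonical_bundle y] sub) auto
    have "continuous_map (top_of_set K) HP3 quaternionic_line"
      by (rule continuous_map_from_subtopology_mono[OF continuous_map_quaternionic_line])
         (auto simp: K_def)
    then show "continuous_map (top_of_set K) (subtopology HP3 ?Z) quaternionic_line"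
      by (auto simp: continuous_map_in_subtopology K_def)
    show "continuous_on K (uminus :: quaternion ^ 4 \<Rightarrow> _)" by (intro continuous_intros)
  qed (use K K_minus in auto)
  define g where "g = (\<lambda>v. qinner (quaternion_coords (a v)) v)"
  have g: "continuous_on K g" "\<And>v. v \<in> K \<Longrightarrow> g (- v) = - g v" "\<And>v. v \<in> K \<Longrightarrow> g v \<noteq> 0"
  proof -
    show "continuous_on K g"
      unfolding g_def qinner_def by (intro continuous_intros a)
    show "g (- v) = - g v" if "v \<in> K" for v
      by (simp add: g_def a(4)[OF that] qinner_minus_right)
    show "g v \<noteq> 0" if "v \<in> K" for v
      unfolding g_def using a(2,3)[OF that]
      by (intro qinner_canonical_bundle_nonzero) (auto simp: first_factor_def)
  qed
  have "closedin (top_of_set (sphere 0 1)) K"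
    using K by (intro closed_subset) (auto simp: K_def compact_imp_closed)
  then obtain G where G: "continuous_on (sphere 0 1) G" "\<And>v. v \<in> K \<Longrightarrow> G v = g v"
    using Tietze_unbounded[OF g(1)] by metis
  \<comment> \<open>The Tietze extension need not be odd. Its antisymmetrisation is, and on
    \<open>K\<close> it equals twice \<open>g\<close>, which stays nonzero.\<close>
  show ?thesis
  proof (rule that[of "\<lambda>v. G v - G (- v)"])
    have "continuous_on (sphere 0 1) (\<lambda>v. G (- v))"
      by (rule continuous_on_compose2[OF G(1)]) (auto intro: continuous_intros)
    then show "continuous_on (sphere 0 1) (\<lambda>v. G v - G (- v))"
      by (intro continuous_on_diff G(1))
    fix v :: "quaternion ^ 4"
    assume "norm v = 1" "quaternionic_line v \<in> ?Z"
    then have "v \<in> K" by (simp add: K_def)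
    then have "G v - G (- v) = 2 *\<^sub>R g v"
      using G(2) g(2) K_minus by (simp add: scaleR_2)
    then show "G v - G (- v) \<noteq> 0" using g(3)[OF \<open>v \<in> K\<close>] by simp
  qed simp
qed

theorem mainTheorem4:
  fixes A B C :: "((quaternion ^ 4) set, 4 \<times> 2) subbundle"
    and P :: "((quaternion ^ 4) set, (4 \<times> 2) \<times> (4 \<times> 2) \<times> (4 \<times> 2)) subbundle"
  assumes "A = canonical_bundle" and "B = canonical_bundle" and "C = canonical_bundle"
    and "P = tensor_bundle A (tensor_bundle B C)"
  shows "\<not> (\<exists>\<Gamma>. continuous_section HP3 P \<Gamma> \<and>
               (\<forall>x\<in>topspace HP3. \<Gamma> x \<noteq> 0) \<and>
               (\<forall>x\<in>topspace HP3. \<Gamma> x \<in> V2' (A x) (B x) (C x)) \<and>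
               untwisted HP3 A B C \<Gamma>)"
proof
  let ?E = canonical_bundle and ?rot = rotate_factors
  assume "\<exists>\<Gamma>. continuous_section HP3 P \<Gamma> \<and> (\<forall>x\<in>topspace HP3. \<Gamma> x \<noteq> 0) \<and>
    (\<forall>x\<in>topspace HP3. \<Gamma> x \<in> V2' (A x) (B x) (C x)) \<and> untwisted HP3 A B C \<Gamma>"
  then obtain \<Gamma> where sec: "continuous_section HP3 (tensor_bundle ?E (tensor_bundle ?E ?E)) \<Gamma>"
    and nz: "\<And>x. x \<in> topspace HP3 \<Longrightarrow> \<Gamma> x \<noteq> 0"
    and V2: "\<And>x. x \<in> topspace HP3 \<Longrightarrow> \<Gamma> x \<in> V2' (?E x) (?E x) (?E x)"
    and untw: "untwisted HP3 ?E ?E ?E \<Gamma>"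
    unfolding assms by blast
  let ?\<Gamma>1 = "?rot \<circ> \<Gamma>" and ?\<Gamma>2 = "?rot \<circ> ?rot \<circ> \<Gamma>"
  let ?Z = "splitting_locus HP3 ?E ?E ?E"
  \<comment> \<open>As the three factors coincide, both rotations of \<Gamma> are sections of the
    same bundle, and one lemma serves all three loci.\<close>
  have sec1: "continuous_section HP3 (tensor_bundle ?E (tensor_bundle ?E ?E)) ?\<Gamma>1"
    and sec2: "continuous_section HP3 (tensor_bundle ?E (tensor_bundle ?E ?E)) ?\<Gamma>2"
    using continuous_section_rotate_factors[OF sec]
      continuous_section_rotate_factors[OF continuous_section_rotate_factors[OF sec]]
    by (simp_all add: o_assoc)
  have un: "untwisted_first HP3 ?E ?E ?E \<Gamma>" "untwisted_first HP3 ?E ?E ?E ?\<Gamma>1"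
    "untwisted_first HP3 ?E ?E ?E ?\<Gamma>2"
    using untw by (auto simp: untwisted_def)
  obtain f0 :: "quaternion ^ 4 \<Rightarrow> quaternion" where f0: "continuous_on (sphere 0 1) f0"
    "\<And>v. norm v = 1 \<Longrightarrow> f0 (- v) = - f0 v"
    "\<And>v. norm v = 1 \<Longrightarrow> quaternionic_line v \<in> ?Z \<Gamma> \<Longrightarrow> f0 v \<noteq> 0"
    using untwisted_first_imp_odd_map[OF sec nz un(1)] by blast
  obtain f1 :: "quaternion ^ 4 \<Rightarrow> quaternion" where f1: "continuous_on (sphere 0 1) f1"
    "\<And>v. norm v = 1 \<Longrightarrow> f1 (- v) = - f1 v"
    "\<And>v. norm v = 1 \<Longrightarrow> quaternionic_line v \<in> ?Z ?\<Gamma>1 \<Longrightarrow> f1 v \<noteq> 0"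
    using untwisted_first_imp_odd_map[OF sec1 _ un(2)] nz by (auto simp: o_def)
  obtain f2 :: "quaternion ^ 4 \<Rightarrow> quaternion" where f2: "continuous_on (sphere 0 1) f2"
    "\<And>v. norm v = 1 \<Longrightarrow> f2 (- v) = - f2 v"
    "\<And>v. norm v = 1 \<Longrightarrow> quaternionic_line v \<in> ?Z ?\<Gamma>2 \<Longrightarrow> f2 v \<noteq> 0"
    using untwisted_first_imp_odd_map[OF sec2 _ un(3)] nz by (auto simp: o_def)
  \<comment> \<open>Three quaternions have real dimension 12, below the dimension 16 of
    \<open>quaternion ^ 4\<close>, so Borsuk-Ulam applies.\<close>
  obtain v where v: "norm v = 1" "(f0 v, f1 v, f2 v) = 0"
  proof (rule Borsuk_Ulam[of "\<lambda>v. (f0 v, f1 v, f2 v)"])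
    show "continuous_on (sphere 0 1) (\<lambda>v. (f0 v, f1 v, f2 v))"
      by (intro continuous_on_Pair f0 f1 f2)
  qed (use f0 f1 f2 in auto)
  let ?x = "quaternionic_line v"
  have x: "?x \<in> topspace HP3" using v(1) by (intro quaternionic_line_in_topspace) auto
  then have "?x \<in> ?Z \<Gamma> \<or> ?x \<in> ?Z ?\<Gamma>1 \<or> ?x \<in> ?Z ?\<Gamma>2"
    using V2[OF x] by (auto simp: V2'_def splitting_locus_def)
  then show False
    using f0(3)[OF v(1)] f1(3)[OF v(1)] f2(3)[OF v(1)] v(2) by (auto simp: zero_prod_def)
qed

end
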